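(* Let $\Phi=(A;\{E_i\}_{i=0}^d;A^*;\{E_i^*\}_{i=0}^d)$ be a tridiagonal system of diameter $d\geq 1$ on $V$ over $\mathbb{K}$, and let $\Delta,\Psi\in\mathrm{End}(V)$ be the linear transformations attached to $\Phi$ as defined in the context. Let $0\le j\le d$ and let $X$ be either of $$\Delta-I-(\theta_0-\theta_d)\Psi,\qquad \Delta^{-1}-I+(\theta_0-\theta_d)\Psi.$$ Then $XE_j^*V\subseteq E_0^*V+E_1^*V+\cdots+E_{j-2}^*V$ if $j\ge2$, and $XE_j^*V=0$ if $j<2$.
   Context: $\mathbb{K}$ is a field, $V$ is a $\mathbb{K}$-vector space of finite positive dimension, $\mathrm{End}(V)$ is the algebra of linear maps $V\to V$, and $I$ is the identity. A tridiagonal pair (TD pair) on $V$ is an ordered pair $A,A^*\in\mathrm{End}(V)$ ($A^*$ is just a name, not an adjoint) such that: (i) $A$ and $A^*$ are each diagonalizable over $\mathbb{K}$; (ii) there is an ordering $\{V_i\}_{i=0}^d$ of the eigenspaces of $A$ with $A^*V_i\subseteq V_{i-1}+V_i+V_{i+1}$ for $0\le i\le d$, where $V_{-1}=V_{d+1}=0$; (iii) there is an ordering $\{V_i^*\}_{i=0}^{\delta}$ of the eigenspaces of $A^*$ with $AV_i^*\subseteq V_{i-1}^*+V_i^*+V_{i+1}^*$ for $0\le i\le\delta$, where $V_{-1}^*=V_{\delta+1}^*=0$; (iv) there is no subspace $W$ of $V$ with $AW\subseteq W$, $A^*W\subseteq W$, $W\ne0$, $W\ne V$. It is known that $d=\delta$;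 this is the diameter, and it is assumed that $d\ge1$. Orderings satisfying (ii) (resp. (iii)) are called standard. The primitive idempotent of a diagonalizable map associated with one of its eigenspaces is the projection of $V$ onto that eigenspace that kills the other eigenspaces. A tridiagonal system (TD system) on $V$ is a sequence $\Phi=(A;\{E_i\}_{i=0}^d;A^*;\{E_i^*\}_{i=0}^d)$ where $A,A^*$ is a TD pair on $V$, $\{E_i\}_{i=0}^d$ is an ordering of the primitive idempotents of $A$ such that $\{E_iV\}_{i=0}^d$ is standard, and $\{E_i^*\}_{i=0}^d$ is an ordering of the primitive idempotents of $A^*$ such that $\{E_i^*V\}_{i=0}^d$ is standard. Let $\theta_i$ be the eigenvalue of $A$ on $E_iV$. For $0\le i\le d$ set $U_i=(E_0^*V+\cdots+E_i^*V)\cap(E_iV+\cdots+E_dV)$ and $U_i^{\Downarrow}=(E_0^*V+\cdots+E_i^*V)\cap(E_0V+\cdots+E_{d-i}V)$. It is known that $V=\bigoplus_{i=0}^dU_i=\bigoplus_{i=0}^dU_i^{\Downarrow}$ (first and second split decompositions). Let $F_i$ be the projection of $V$ onto $U_i$ along $\bigoplus_{j\ne i}U_j$, and $F_i^{\Downarrow}$ the projection of $V$ onto $U_i^{\Downarrow}$ along $\bigoplus_{j\ne i}U_j^{\Downarrow}$. Define $\Delta=\sum_{h=0}^dF_h^{\Downarrow}F_h$; it is invertible. For $0\le i\le d/2$ set $K_i=(E_0^*V+\cdots+E_i^*V)\cap(E_iV+E_{i+1}V+\cdots+E_{d-i}V)$. For $0\le i\le j\le d+1$ set $\tau_{ij}=(x-\theta_i)(x-\theta_{i+1})\cdots(x-\theta_{j-1})\in\mathbb{K}[x]$,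 with $\tau_{ii}=1$ and $\tau_{i,i-1}=0$. For $0\le i\le d+1$ set $\vartheta_i=\sum_{h=0}^{i-1}\frac{\theta_h-\theta_{d-h}}{\theta_0-\theta_d}$. It is known that $V=\bigoplus_{0\le i\le d/2}\bigoplus_{j=i}^{d-i}\tau_{ij}(A)K_i$. $\Psi$ is the unique element of $\mathrm{End}(V)$ such that $\Psi\tau_{ij}(A)v=(\vartheta_j-\vartheta_i)\tau_{i,j-1}(A)v$ for all $0\le i\le d/2$, $i\le j\le d-i$, $v\in K_i$. *)

theory Defs
  imports "HOL-Library.Set_Algebras" "HOL-Computational_Algebra.Polynomial"
begin

text \<open>
  The vector space is the whole type \<open>'v\<close> with scalar multiplication \<open>scale\<close>.
  Sums of subspaces are written with the elementwise operations of
  \<open>HOL-Library.Set_Algebras\<close>; in particular the empty sum of subspaces is \<open>{0}\<close>.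
\<close>

definition eigenspace ::
    "('k::field \<Rightarrow> 'v::ab_group_add \<Rightarrow> 'v) \<Rightarrow> ('v \<Rightarrow> 'v) \<Rightarrow> 'k \<Rightarrow> 'v set" where
  "eigenspace scale A c = {v. A v = scale c v}"

definition eigenspaces ::
    "('k::field \<Rightarrow> 'v::ab_group_add \<Rightarrow> 'v) \<Rightarrow> ('v \<Rightarrow> 'v) \<Rightarrow> 'v set set" where
  "eigenspaces scale A = {eigenspace scale A c | c. eigenspace scale A c \<noteq> {0}}"

definition diagonalizable ::
    "('k::field \<Rightarrow> 'v::ab_group_add \<Rightarrow> 'v) \<Rightarrow> ('v \<Rightarrow> 'v) \<Rightarrow> bool" where
  "diagonalizable scale A \<longleftrightarrow>
    (\<exists>B. \<not> module.dependent scale B \<and> module.span scale B = UNIV \<and>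
         (\<forall>b\<in>B. \<exists>c. A b = scale c b))"

definition standard_ordering ::
    "('k::field \<Rightarrow> 'v::ab_group_add \<Rightarrow> 'v) \<Rightarrow> ('v \<Rightarrow> 'v) \<Rightarrow> ('v \<Rightarrow> 'v) \<Rightarrow> nat \<Rightarrow>
      (nat \<Rightarrow> 'v set) \<Rightarrow> bool" where
  "standard_ordering scale A As d W \<longleftrightarrow>
    bij_betw W {..d} (eigenspaces scale A) \<and>
    (\<forall>i\<le>d. As ` W i \<subseteq>
       (if i = 0 then {0} else W (i - 1)) + W i + (if i = d then {0} else W (i + 1)))"

definition td_pair ::
    "('k::field \<Rightarrow> 'v::ab_group_add \<Rightarrow> 'v) \<Rightarrow> ('v \<Rightarrow> 'v) \<Rightarrow> ('v \<Rightarrow> 'v) \<Rightarrow> bool" where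
  "td_pair scale A As \<longleftrightarrow>
    Vector_Spaces.linear scale scale A \<and> Vector_Spaces.linear scale scale As \<and>
    diagonalizable scale A \<and> diagonalizable scale As \<and>
    (\<exists>d W. standard_ordering scale A As d W) \<and>
    (\<exists>\<delta> Ws. standard_ordering scale As A \<delta> Ws) \<and>
    \<not> (\<exists>W. module.subspace scale W \<and> A ` W \<subseteq> W \<and> As ` W \<subseteq> W \<and> W \<noteq> {0} \<and> W \<noteq> UNIV)"

text \<open>
  \<open>F\<close> is the projection onto \<open>W\<close> that kills \<open>N\<close>. This determines \<open>F\<close> whenever
  the space is the direct sum of \<open>W\<close> and the span of \<open>N\<close>.
\<close>

definition is_projection ::
    "('k::field \<Rightarrow> 'v::ab_group_add \<Rightarrow> 'v) \<Rightarrow> 'v set \<Rightarrow> 'v set \<Rightarrow> ('v \<Rightarrow> 'v) \<Rightarrow> bool" where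
  "is_projection scale W N F \<longleftrightarrow>
    Vector_Spaces.linear scale scale F \<and> range F = W \<and>
    (\<forall>v\<in>W. F v = v) \<and> (\<forall>v\<in>N. F v = 0)"

definition primitive_idempotents ::
    "('k::field \<Rightarrow> 'v::ab_group_add \<Rightarrow> 'v) \<Rightarrow> ('v \<Rightarrow> 'v) \<Rightarrow> ('v \<Rightarrow> 'v) set" where
  "primitive_idempotents scale A =
    {F. \<exists>W\<in>eigenspaces scale A. is_projection scale W (\<Union>(eigenspaces scale A - {W})) F}"

definition td_system ::
    "('k::field \<Rightarrow> 'v::ab_group_add \<Rightarrow> 'v) \<Rightarrow> nat \<Rightarrow> ('v \<Rightarrow> 'v) \<Rightarrow> (nat \<Rightarrow> 'v \<Rightarrow> 'v) \<Rightarrow>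
      ('v \<Rightarrow> 'v) \<Rightarrow> (nat \<Rightarrow> 'v \<Rightarrow> 'v) \<Rightarrow> bool" where
  "td_system scale d A E As Es \<longleftrightarrow>
    td_pair scale A As \<and>
    bij_betw E {..d} (primitive_idempotents scale A) \<and>
    standard_ordering scale A As d (\<lambda>i. range (E i)) \<and>
    bij_betw Es {..d} (primitive_idempotents scale As) \<and>
    standard_ordering scale As A d (\<lambda>i. range (Es i))"

definition td_theta ::
    "('k::field \<Rightarrow> 'v::ab_group_add \<Rightarrow> 'v) \<Rightarrow> ('v \<Rightarrow> 'v) \<Rightarrow> (nat \<Rightarrow> 'v \<Rightarrow> 'v) \<Rightarrow> nat \<Rightarrow> 'k" where
  "td_theta scale A E i = (THE c. \<forall>v\<in>range (E i). A v = scale c v)"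

definition split_U ::
    "nat \<Rightarrow> (nat \<Rightarrow> 'v::ab_group_add \<Rightarrow> 'v) \<Rightarrow> (nat \<Rightarrow> 'v \<Rightarrow> 'v) \<Rightarrow> nat \<Rightarrow> 'v set" where
  "split_U d E Es i = (\<Sum>h\<in>{0..i}. range (Es h)) \<inter> (\<Sum>h\<in>{i..d}. range (E h))"

definition split_U_down ::
    "nat \<Rightarrow> (nat \<Rightarrow> 'v::ab_group_add \<Rightarrow> 'v) \<Rightarrow> (nat \<Rightarrow> 'v \<Rightarrow> 'v) \<Rightarrow> nat \<Rightarrow> 'v set" where
  "split_U_down d E Es i = (\<Sum>h\<in>{0..i}. range (Es h)) \<inter> (\<Sum>h\<in>{0..d - i}. range (E h))"

definition component_projection ::
    "('k::field \<Rightarrow> 'v::ab_group_add \<Rightarrow> 'v) \<Rightarrow> nat \<Rightarrow> (nat \<Rightarrow> 'v set) \<Rightarrow> nat \<Rightarrow> 'v \<Rightarrow> 'v" where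
  "component_projection scale d U i =
    (THE F. is_projection scale (U i) (\<Sum>j\<in>{0..d} - {i}. U j) F)"

definition td_Delta ::
    "('k::field \<Rightarrow> 'v::ab_group_add \<Rightarrow> 'v) \<Rightarrow> nat \<Rightarrow> (nat \<Rightarrow> 'v \<Rightarrow> 'v) \<Rightarrow> (nat \<Rightarrow> 'v \<Rightarrow> 'v) \<Rightarrow>
      'v \<Rightarrow> 'v" where
  "td_Delta scale d E Es v =
    (\<Sum>h=0..d. component_projection scale d (split_U_down d E Es) h
                (component_projection scale d (split_U d E Es) h v))"

definition td_K ::
    "nat \<Rightarrow> (nat \<Rightarrow> 'v::ab_group_add \<Rightarrow> 'v) \<Rightarrow> (nat \<Rightarrow> 'v \<Rightarrow> 'v) \<Rightarrow> nat \<Rightarrow> 'v set" where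
  "td_K d E Es i = (\<Sum>h\<in>{0..i}. range (Es h)) \<inter> (\<Sum>h\<in>{i..d - i}. range (E h))"

definition td_tau :: "(nat \<Rightarrow> 'k::field) \<Rightarrow> nat \<Rightarrow> nat \<Rightarrow> 'k poly" where
  "td_tau \<theta> i j = (if j < i then 0 else (\<Prod>h\<in>{i..<j}. [:- \<theta> h, 1:]))"

definition poly_endo ::
    "('k::field \<Rightarrow> 'v::ab_group_add \<Rightarrow> 'v) \<Rightarrow> 'k poly \<Rightarrow> ('v \<Rightarrow> 'v) \<Rightarrow> 'v \<Rightarrow> 'v" where
  "poly_endo scale p A v = (\<Sum>k\<le>degree p. scale (coeff p k) ((A ^^ k) v))"

definition td_vartheta :: "nat \<Rightarrow> (nat \<Rightarrow> 'k::field) \<Rightarrow> nat \<Rightarrow> 'k" where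
  "td_vartheta d \<theta> i = (\<Sum>h<i. (\<theta> h - \<theta> (d - h)) / (\<theta> 0 - \<theta> d))"

text \<open>
  For \<open>i = j = 0\<close> the natural number \<open>j - 1\<close> is truncated to \<open>0\<close>; the polynomial
  \<open>td_tau \<theta> 0 (- 1) = 0\<close> would be intended there, but the coefficient
  \<open>td_vartheta d \<theta> j - td_vartheta d \<theta> i\<close> vanishes anyway.
\<close>

definition td_Psi ::
    "('k::field \<Rightarrow> 'v::ab_group_add \<Rightarrow> 'v) \<Rightarrow> nat \<Rightarrow> ('v \<Rightarrow> 'v) \<Rightarrow> (nat \<Rightarrow> 'v \<Rightarrow> 'v) \<Rightarrow>
      (nat \<Rightarrow> 'v \<Rightarrow> 'v) \<Rightarrow> 'v \<Rightarrow> 'v" where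
  "td_Psi scale d A E Es =
    (let \<theta> = td_theta scale A E in
     THE P. Vector_Spaces.linear scale scale P \<and>
       (\<forall>i j. 2 * i \<le> d \<longrightarrow> i \<le> j \<longrightarrow> j \<le> d - i \<longrightarrow>
         (\<forall>v\<in>td_K d E Es i.
            P (poly_endo scale (td_tau \<theta> i j) A v) =
            scale (td_vartheta d \<theta> j - td_vartheta d \<theta> i)
              (poly_endo scale (td_tau \<theta> i (j - 1)) A v))))"

end

theory Submission imports Defs begin

text \<open>
  Every space in the statement is cut out by the vanishing of some idempotents: with
  \<open>below k = E*\<^sub>0V + \<dots> + E*\<^sub>k\<^sub>-\<^sub>1V\<close> and \<open>above k = E\<^sub>kV + \<dots> + E\<^sub>dV\<close> the first split
  decomposition is \<open>U\<^sub>k = below (k + 1) \<inter> above k\<close>, and the second one is the first one of the system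
  in which the order of the \<open>E\<^sub>i\<close> is reversed. Half-open bounds have the effect that the two cases
  \<open>j \<ge> 2\<close> and \<open>j < 2\<close> of the theorem both say \<open>X E*\<^sub>jV \<subseteq> below (j - 1)\<close>, with truncated
  subtraction.

  The heart of the matter is a comparison of two polynomials. Let \<open>v \<in> K\<^sub>i\<close> and \<open>i \<le> j \<le> d - i\<close>,
  let \<open>\<tau>\<close> be the product of \<open>x - \<theta>\<^sub>h\<close> and \<open>\<eta>\<close> the product of \<open>x - \<theta>\<^sub>d\<^sub>-\<^sub>h\<close> over \<open>i \<le> h < j\<close>.
  Then \<open>\<tau>(A)v\<close> lies in \<open>U\<^sub>j\<close>, \<open>\<eta>(A)v\<close> lies in the \<open>j\<close>-th component of the second split
  decomposition, and since both polynomials are monic of degree \<open>j - i\<close> the two vectors differ by an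
  element of \<open>below j\<close>, the sum of the earlier components. Hence \<open>\<Delta> \<tau>(A)v = \<eta>(A)v\<close>
  (\<open>td_Delta_tau\<close>). The coefficients of \<open>x ^ (j - i - 1)\<close> in \<open>\<eta>\<close> and \<open>\<tau>\<close> differ by the sum of
  \<open>\<theta>\<^sub>h - \<theta>\<^sub>d\<^sub>-\<^sub>h\<close> over \<open>i \<le> h < j\<close>, which is exactly the factor with which \<open>(\<theta>\<^sub>0 - \<theta>\<^sub>d) \<Psi>\<close> sends
  \<open>\<tau>(A)v\<close> to a multiple of \<open>\<tau>\<^sub>i\<^sub>,\<^sub>j\<^sub>-\<^sub>1(A)v\<close>. So \<open>\<Delta> - I - (\<theta>\<^sub>0 - \<theta>\<^sub>d) \<Psi>\<close> acts on \<open>\<tau>(A)v\<close> as a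
  polynomial in \<open>A\<close> of degree at most \<open>j - i - 2\<close>, which is zero if \<open>j - i < 2\<close>, acts on \<open>v\<close>. As \<open>A\<close> maps \<open>below k\<close> into
  \<open>below (k + 1)\<close>, the image lies in \<open>below (j - 1)\<close> (\<open>Delta_minus_Psi_below\<close>).
  For \<open>\<Delta>\<inverse>\<close>, put \<open>N = \<Delta> - I\<close>, which lowers the flag \<open>below\<close> by one step; modulo two steps
  \<open>\<Delta>\<inverse> - I\<close> equals \<open>- N\<close> (\<open>inv_Delta_plus_Psi_below\<close>).

  This argument needs that \<open>\<Delta>\<close> and \<open>\<Psi>\<close> are what their definitions intend, that is,
  that the sums of the \<open>U\<^sub>k\<close> and of the \<open>\<tau>\<^sub>i\<^sub>j(A)K\<^sub>i\<close> are direct and exhaust \<open>V\<close>, with \<open>\<tau>\<^sub>i\<^sub>j(A)\<close>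
  injective on \<open>K\<^sub>i\<close>. Irreducibility enters through one observation: the span of all
  \<open>below (k + c) \<inter> above k\<close>, for \<open>c = 0\<close> or \<open>c = 1\<close>, is invariant under both maps
  (\<open>diagonal_span_invariant\<close>). For \<open>c = 0\<close> it is a proper subspace and hence zero; for \<open>c = 1\<close> it is
  nonzero and hence \<open>V\<close>. The refined decomposition also needs that \<open>\<tau>\<^sub>i\<^sub>,\<^sub>d\<^sub>-\<^sub>i(A)\<close> maps \<open>U\<^sub>i\<close> onto
  \<open>U\<^sub>d\<^sub>-\<^sub>i\<close>. It is injective there, and the same statement for the system with the two maps exchanged
  and both orders reversed gives an injective linear map back, so finite dimension makes both
  bijective (\<open>tau_surjective_U\<close>).
\<close>

section \<open>Linear maps on direct sums\<close>

locale linear_operators = vector_space scale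
  for scale :: "'k::field \<Rightarrow> 'v::ab_group_add \<Rightarrow> 'v"
begin

abbreviation lin :: "('v \<Rightarrow> 'v) \<Rightarrow> bool" where
  "lin \<equiv> Vector_Spaces.linear scale scale"

lemma lin_iff:
  "lin f \<longleftrightarrow> (\<forall>x y. f (x + y) = f x + f y) \<and> (\<forall>c x. f (scale c x) = scale c (f x))"
  using vector_space_axioms by (auto simp: Vector_Spaces.linear_iff)

lemma lin_add: "lin f \<Longrightarrow> f (x + y) = f x + f y"
  and lin_scale: "lin f \<Longrightarrow> f (scale c x) = scale c (f x)"
  by (auto simp: lin_iff)

lemma lin_0: "lin f \<Longrightarrow> f 0 = 0"
  by (metis add_cancel_right_left lin_add)

lemma lin_diff: "lin f \<Longrightarrow> f (x - y) = f x - f y"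
  by (metis add_diff_cancel_right' diff_add_cancel lin_add)

lemma lin_sum: "lin f \<Longrightarrow> f (sum g S) = (\<Sum>a\<in>S. f (g a))"
  by (induct S rule: infinite_finite_induct) (auto simp: lin_0 lin_add)

lemma lin_comp: "lin f \<Longrightarrow> lin g \<Longrightarrow> lin (\<lambda>x. f (g x))"
  by (simp add: lin_iff)

lemma lin_sum_fun: "(\<And>i. i \<in> I \<Longrightarrow> lin (f i)) \<Longrightarrow> lin (\<lambda>x. \<Sum>i\<in>I. f i x)"
  by (simp add: lin_iff sum.distrib scale_sum_right)

lemma lin_scale_fun: "lin f \<Longrightarrow> lin (\<lambda>x. scale c (f x))"
  by (simp add: lin_iff scale_right_distrib scale_left_commute)

lemma lin_image_span_subset:
  assumes "lin f" and "\<And>x. x \<in> S \<Longrightarrow> f x \<in> T" and "subspace T"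
  shows "f ` span S \<subseteq> T"
proof -
  have "f x \<in> T" if "x \<in> span S" for x
    using that
  proof (induction rule: span_induct)
    case (step x) then show ?case using assms by auto
  next
    case base
    show ?case
      unfolding subspace_def using assms
      by (auto simp: lin_0 lin_add lin_scale subspace_0 subspace_add subspace_scale)
  qed
  then show ?thesis by auto
qed

lemma span_UN_image_imp_sum:
  assumes "finite P" and g: "\<And>p. p \<in> P \<Longrightarrow> lin (g p)" and K: "\<And>p. p \<in> P \<Longrightarrow> subspace (K p)"
    and "v \<in> span (\<Union>p\<in>P. g p ` K p)"
  shows "\<exists>k. (\<forall>p\<in>P. k p \<in> K p) \<and> v = (\<Sum>p\<in>P. g p (k p))"
  using assms(4)
proof (induction rule: span_induct)
  case (step x)
  then obtain p y where p: "p \<in> P" "y \<in> K p" "x = g p y" by auto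
  have "(\<Sum>q\<in>P. g q (if q = p then y else 0)) = (\<Sum>q\<in>P. if q = p then g q y else 0)"
    using g by (intro sum.cong) (auto simp: lin_0)
  also have "\<dots> = x" using p \<open>finite P\<close> by simp
  finally show ?case
    using p K by (intro exI[of _ "\<lambda>q. if q = p then y else 0"]) (auto simp: subspace_0)
next
  case base
  show ?case
    unfolding subspace_def mem_Collect_eq
  proof (intro conjI ballI allI)
    show "\<exists>k. (\<forall>p\<in>P. k p \<in> K p) \<and> 0 = (\<Sum>p\<in>P. g p (k p))"
      using g K by (intro exI[of _ "\<lambda>_. 0"]) (auto simp: lin_0 subspace_0)
  next
    fix x y
    assume "x \<in> {v. \<exists>k. (\<forall>p\<in>P. k p \<in> K p) \<and> v = (\<Sum>p\<in>P. g p (k p))}"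
      and "y \<in> {v. \<exists>k. (\<forall>p\<in>P. k p \<in> K p) \<and> v = (\<Sum>p\<in>P. g p (k p))}"
    then obtain k l where "\<forall>p\<in>P. k p \<in> K p" "x = (\<Sum>p\<in>P. g p (k p))"
      "\<forall>p\<in>P. l p \<in> K p" "y = (\<Sum>p\<in>P. g p (l p))" by auto
    then show "\<exists>k. (\<forall>p\<in>P. k p \<in> K p) \<and> x + y = (\<Sum>p\<in>P. g p (k p))"
      using g K by (intro exI[of _ "\<lambda>p. k p + l p"])
        (auto simp: lin_add subspace_add sum.distrib[symmetric] intro!: sum.cong)
  next
    fix c x
    assume "x \<in> {v. \<exists>k. (\<forall>p\<in>P. k p \<in> K p) \<and> v = (\<Sum>p\<in>P. g p (k p))}"
    then obtain k where "\<forall>p\<in>P. k p \<in> K p" "x = (\<Sum>p\<in>P. g p (k p))" by auto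
    then show "\<exists>k. (\<forall>p\<in>P. k p \<in> K p) \<and> scale c x = (\<Sum>p\<in>P. g p (k p))"
      using g K by (intro exI[of _ "\<lambda>p. scale c (k p)"])
        (auto simp: lin_scale subspace_scale scale_sum_right intro!: sum.cong)
  qed
qed

text \<open>
  The pieces of the direct sum are given as images \<open>g p ` K p\<close>, and the linear map is
  prescribed on the parameter \<open>x \<in> K p\<close>. Independence is required of the parameters, so
  it contains the injectivity of \<open>g p\<close> on \<open>K p\<close>, without which the prescription could be
  contradictory.
\<close>
lemma exists_linear_on_direct_sum:
  assumes "finite P" and g: "\<And>p. p \<in> P \<Longrightarrow> lin (g p)" and h: "\<And>p. p \<in> P \<Longrightarrow> lin (h p)"
    and K: "\<And>p. p \<in> P \<Longrightarrow> subspace (K p)"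
    and span: "span (\<Union>p\<in>P. g p ` K p) = UNIV"
    and indep: "\<And>k. (\<And>p. p \<in> P \<Longrightarrow> k p \<in> K p) \<Longrightarrow> (\<Sum>p\<in>P. g p (k p)) = 0 \<Longrightarrow> (\<And>p. p \<in> P \<Longrightarrow> k p = 0)"
  shows "\<exists>f. lin f \<and> (\<forall>p\<in>P. \<forall>x\<in>K p. f (g p x) = h p x)"
proof -
  have "\<forall>v. \<exists>k. (\<forall>p\<in>P. k p \<in> K p) \<and> v = (\<Sum>p\<in>P. g p (k p))"
    using span_UN_image_imp_sum[where g = g and K = K, OF assms(1) g K] span by blast
  then obtain c where c: "\<And>v p. p \<in> P \<Longrightarrow> c v p \<in> K p" "\<And>v. v = (\<Sum>p\<in>P. g p (c v p))"
    by metis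
  define f where "f v = (\<Sum>p\<in>P. h p (c v p))" for v
  have f: "f (\<Sum>p\<in>P. g p (k p)) = (\<Sum>p\<in>P. h p (k p))" if k: "\<And>p. p \<in> P \<Longrightarrow> k p \<in> K p" for k
  proof -
    let ?v = "\<Sum>p\<in>P. g p (k p)"
    have "(\<Sum>p\<in>P. g p (k p - c ?v p)) = ?v - (\<Sum>p\<in>P. g p (c ?v p))"
      using g by (simp add: lin_diff sum_subtractf)
    also have "\<dots> = 0" unfolding right_minus_eq by (rule c(2))
    finally have 0: "(\<Sum>p\<in>P. g p (k p - c ?v p)) = 0" .
    have "k p - c ?v p = 0" if "p \<in> P" for p
      by (rule indep[OF _ 0 that]) (intro subspace_diff K k c(1))
    then show ?thesis unfolding f_def by (intro sum.cong) (auto simp only: right_minus_eq)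
  qed
  have "f (x + y) = f x + f y" for x y
  proof -
    have "(\<Sum>p\<in>P. g p (c x p + c y p)) = x + y"
      using g by (simp add: lin_add sum.distrib c(2)[symmetric])
    then have "f (x + y) = (\<Sum>p\<in>P. h p (c x p + c y p))"
      using f[of "\<lambda>p. c x p + c y p"] c(1) K by (simp add: subspace_add)
    then show ?thesis using h by (simp add: f_def lin_add sum.distrib)
  qed
  moreover have "f (scale a x) = scale a (f x)" for a x
  proof -
    have "(\<Sum>p\<in>P. g p (scale a (c x p))) = scale a x"
      using g by (simp add: lin_scale scale_sum_right[symmetric] c(2)[symmetric])
    then have "f (scale a x) = (\<Sum>p\<in>P. h p (scale a (c x p)))"
      using f[of "\<lambda>p. scale a (c x p)"] c(1) K by (simp add: subspace_scale)
    then show ?thesis using h by (simp add: f_def lin_scale scale_sum_right)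
  qed
  moreover have "f (g p x) = h p x" if p: "p \<in> P" "x \<in> K p" for p x
  proof -
    let ?k = "\<lambda>q. if q = p then x else 0"
    have "(\<Sum>q\<in>P. g q (?k q)) = (\<Sum>q\<in>P. if q = p then g q x else 0)"
      and "(\<Sum>q\<in>P. h q (?k q)) = (\<Sum>q\<in>P. if q = p then h q x else 0)"
      using g h by (auto simp: lin_0 intro!: sum.cong)
    then show ?thesis
      using f[of ?k] p K \<open>finite P\<close> by (simp add: subspace_0)
  qed
  ultimately show ?thesis by (intro exI[of _ f]) (simp add: lin_iff)
qed

lemma lin_eq_on_span:
  assumes "lin f" "lin g" "\<And>x. x \<in> S \<Longrightarrow> f x = g x" "span S = UNIV"
  shows "f = g"
proof
  fix x
  have "x \<in> span S" using assms by simp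
  then show "f x = g x"
  proof (induction rule: span_induct)
    case base
    then show ?case using assms(1,2)
      by (auto simp: subspace_def lin_0 lin_add lin_scale)
  qed (use assms in auto)
qed

text \<open>
  The projection is a definite description; a direct sum decomposition supplies existence through
  \<open>exists_linear_on_direct_sum\<close> and uniqueness because the components span.
\<close>
lemma component_projection_direct_sum:
  assumes U: "\<And>j. j \<le> d \<Longrightarrow> subspace (U j)"
    and span: "span (\<Union>j\<in>{..d}. U j) = UNIV"
    and indep: "\<forall>u. (\<forall>j\<le>d. u j \<in> U j) \<longrightarrow> (\<Sum>j\<le>d. u j) = 0 \<longrightarrow> (\<forall>j\<le>d. u j = 0)"
    and i: "i \<le> d"
  defines "F \<equiv> component_projection scale d U i"
  shows "lin F" and "\<And>v. v \<in> U i \<Longrightarrow> F v = v"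
    and "\<And>j v. j \<le> d \<Longrightarrow> j \<noteq> i \<Longrightarrow> v \<in> U j \<Longrightarrow> F v = 0"
proof -
  let ?N = "\<Sum>j\<in>{0..d} - {i}. U j"
  have "\<exists>f. lin f \<and> (\<forall>j\<in>{..d}. \<forall>x\<in>U j. f x = (if j = i then x else 0))"
    using exists_linear_on_direct_sum[of "{..d}" "\<lambda>_ x. x" "\<lambda>j x. if j = i then x else 0" U]
      U span indep by (simp add: lin_iff)
  then obtain f where f: "lin f" "\<And>x. x \<in> U i \<Longrightarrow> f x = x"
      "\<And>j x. j \<le> d \<Longrightarrow> j \<noteq> i \<Longrightarrow> x \<in> U j \<Longrightarrow> f x = 0" using i by (metis atMost_iff)
  have UN: "U j \<subseteq> ?N" if "j \<le> d" "j \<noteq> i" for j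
  proof
    fix x assume "x \<in> U j"
    then show "x \<in> ?N" unfolding set_sum_alt[OF finite_Diff[OF finite_atLeastAtMost]]
      using that U \<open>x \<in> U j\<close>
      by (auto intro!: exI[of _ "\<lambda>q. if q = j then x else 0"] simp: subspace_0 split: if_splits)
  qed
  have fN: "f x = 0" if "x \<in> ?N" for x
  proof -
    obtain s where s: "x = sum s ({0..d} - {i})" "\<forall>j\<in>{0..d} - {i}. s j \<in> U j"
      using \<open>x \<in> ?N\<close> unfolding set_sum_alt[OF finite_Diff[OF finite_atLeastAtMost]] by auto
    show ?thesis unfolding s(1) lin_sum[OF f(1)] using f(3) s(2)
      by (intro sum.neutral ballI) (metis Diff_iff atLeastAtMost_iff singletonI)
  qed
  have "f ` span (\<Union>j\<in>{..d}. U j) \<subseteq> U i"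
  proof (rule lin_image_span_subset[OF f(1) _ U[OF i]])
    fix x assume "x \<in> (\<Union>j\<in>{..d}. U j)"
    then obtain j where "j \<le> d" "x \<in> U j" by auto
    then show "f x \<in> U i"
      using f(2,3) subspace_0[OF U[OF i]] by (cases "j = i") auto
  qed
  then have "range f \<subseteq> U i" using span by simp
  moreover have "U i \<subseteq> range f" using f(2) by (metis rangeI subsetI)
  ultimately have "range f = U i" by blast
  then have proj: "is_projection scale (U i) ?N f"
    unfolding is_projection_def using f fN by auto
  have "F = f"
    unfolding F_def component_projection_def
  proof (rule the_equality)
    show "is_projection scale (U i) ?N f" by (rule proj)
  next
    fix f' assume f': "is_projection scale (U i) ?N f'"
    show "f' = f"
    proof (rule lin_eq_on_span[OF _ f(1) _ span])
      show "lin f'" using f' by (simp add: is_projection_def)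
      fix x assume "x \<in> (\<Union>j\<in>{..d}. U j)"
      then obtain j where j: "j \<le> d" "x \<in> U j" by auto
      then show "f' x = f x"
        using f' f UN[of j] by (cases "j = i") (auto simp: is_projection_def)
    qed
  qed
  then show "lin F" and "\<And>v. v \<in> U i \<Longrightarrow> F v = v"
    and "\<And>j v. j \<le> d \<Longrightarrow> j \<noteq> i \<Longrightarrow> v \<in> U j \<Longrightarrow> F v = 0" using f by auto
qed

end

section \<open>Diagonalizable maps and their flags\<close>

text \<open>
  A diagonalizable map given through its primitive idempotents. In this form intersections of
  sums of eigenspaces are intersections of vanishing conditions \<open>E h v = 0\<close>, and a
  polynomial in the map acts on each condition through a scalar.
\<close>
locale resolved_map = linear_operators scale
  for scale :: "'k::field \<Rightarrow> 'v::ab_group_add \<Rightarrow> 'v" +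
  fixes d :: nat and A :: "'v \<Rightarrow> 'v" and E :: "nat \<Rightarrow> 'v \<Rightarrow> 'v" and \<theta> :: "nat \<Rightarrow> 'k"
  assumes lin_A: "lin A"
    and lin_E: "i \<le> d \<Longrightarrow> lin (E i)"
    and E_E: "i \<le> d \<Longrightarrow> j \<le> d \<Longrightarrow> E i (E j v) = (if i = j then E j v else 0)"
    and sum_E: "(\<Sum>i\<le>d. E i v) = v"
    and A_E: "i \<le> d \<Longrightarrow> A (E i v) = scale (\<theta> i) (E i v)"
    and E_nonzero: "i \<le> d \<Longrightarrow> \<exists>v. E i v \<noteq> 0"
    and inj_theta: "inj_on \<theta> {..d}"
begin

lemma theta_eq_iff: "i \<le> d \<Longrightarrow> j \<le> d \<Longrightarrow> \<theta> i = \<theta> j \<longleftrightarrow> i = j"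
  using inj_theta by (auto simp: inj_on_def)

lemma E_A: "i \<le> d \<Longrightarrow> E i (A v) = scale (\<theta> i) (E i v)"
proof -
  assume i: "i \<le> d"
  have "E i (A v) = E i (A (\<Sum>j\<le>d. E j v))" by (simp add: sum_E)
  also have "\<dots> = (\<Sum>j\<le>d. E i (A (E j v)))" using i by (simp add: lin_sum lin_A lin_E)
  also have "\<dots> = (\<Sum>j\<le>d. if j = i then scale (\<theta> i) (E i v) else 0)"
    using i by (intro sum.cong) (auto simp: A_E lin_scale lin_E E_E)
  finally show ?thesis using i by simp
qed

lemma E_eqI: "(\<And>h. h \<le> d \<Longrightarrow> E h v = E h w) \<Longrightarrow> v = w"
  by (metis (no_types, lifting) atMost_iff sum.cong sum_E)

lemma E_funpow: "i \<le> d \<Longrightarrow> E i ((A ^^ n) v) = scale (\<theta> i ^ n) (E i v)"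
  by (induction n) (auto simp: E_A)

lemma E_poly:
  assumes "h \<le> d" shows "E h (poly_endo scale p A v) = scale (poly p (\<theta> h)) (E h v)"
  using assms unfolding poly_endo_def poly_altdef
  by (simp add: lin_sum lin_E lin_scale E_funpow scale_sum_left)

lemma lin_poly: "lin (poly_endo scale p A)"
proof -
  have "lin (A ^^ n)" for n
    by (induction n) (simp_all add: lin_iff lin_add[OF lin_A] lin_scale[OF lin_A])
  then show ?thesis unfolding poly_endo_def[abs_def]
    by (intro lin_sum_fun lin_scale_fun)
qed

lemma poly_endo_mult:
  "poly_endo scale (p * q) A v = poly_endo scale p A (poly_endo scale q A v)"
  by (rule E_eqI) (simp add: E_poly)

lemma poly_endo_diff:
  "poly_endo scale (p - q) A v = poly_endo scale p A v - poly_endo scale q A v"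
  by (rule E_eqI) (simp add: E_poly lin_diff lin_E scale_left_diff_distrib)

lemma poly_endo_smult:
  "poly_endo scale (smult c p) A v = scale c (poly_endo scale p A v)"
  by (rule E_eqI) (simp add: E_poly lin_scale lin_E)

lemma poly_endo_1: "poly_endo scale 1 A v = v"
  by (rule E_eqI) (simp add: E_poly)

lemma resolved_map_reverse: "resolved_map scale d A (\<lambda>i. E (d - i)) (\<lambda>i. \<theta> (d - i))"
proof unfold_locales
  show "(\<Sum>i\<le>d. E (d - i) v) = v" for v
    using sum.nat_diff_reindex[of "\<lambda>i. E i v" "Suc d"] sum_E[of v] by (simp add: lessThan_Suc_atMost)
  show "inj_on (\<lambda>i. \<theta> (d - i)) {..d}"
    by (auto simp: inj_on_def theta_eq_iff)
  show "E (d - i) (E (d - j) v) = (if i = j then E (d - j) v else 0)"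
    if "i \<le> d" "j \<le> d" for i j v
    using that by (auto simp: E_E)
qed (simp_all add: lin_A A_E E_nonzero lin_add lin_scale lin_E)

end

text \<open>
  Partial sums of the eigenspaces, as vanishing conditions on the complementary idempotents. The
  bound is excluded in \<open>below\<close> and included in \<open>above\<close>; the index \<open>0\<close> gives the zero space in
  the former, and any index beyond \<open>d\<close> gives it in the latter.
\<close>
definition below :: "nat \<Rightarrow> (nat \<Rightarrow> 'v::ab_group_add \<Rightarrow> 'v) \<Rightarrow> nat \<Rightarrow> 'v set" where
  "below d E k = {v. \<forall>h\<le>d. k \<le> h \<longrightarrow> E h v = 0}"

definition above :: "nat \<Rightarrow> (nat \<Rightarrow> 'v::ab_group_add \<Rightarrow> 'v) \<Rightarrow> nat \<Rightarrow> 'v set" where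
  "above d E k = {v. \<forall>h\<le>d. h < k \<longrightarrow> E h v = 0}"

lemma below_mono: "k \<le> l \<Longrightarrow> below d E k \<subseteq> below d E l"
  and above_antimono: "k \<le> l \<Longrightarrow> above d E l \<subseteq> above d E k"
  by (auto simp: below_def above_def)

lemma below_reverse: "k \<le> d \<Longrightarrow> below d (\<lambda>i. E (d - i)) (Suc k) = above d E (d - k)"
proof -
  assume "k \<le> d"
  have "E h v = 0" if "\<forall>h\<le>d. Suc k \<le> h \<longrightarrow> E (d - h) v = 0" "h \<le> d" "h < d - k" for h v
    using that(1)[rule_format, of "d - h"] that(2,3) by simp
  then show ?thesis using \<open>k \<le> d\<close> by (auto simp: below_def above_def)
qed

lemma above_reverse: "k \<le> d \<Longrightarrow> above d (\<lambda>i. E (d - i)) k = below d E (Suc (d - k))"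
proof -
  assume "k \<le> d"
  have "E h v = 0" if "\<forall>h\<le>d. h < k \<longrightarrow> E (d - h) v = 0" "h \<le> d" "Suc (d - k) \<le> h" for h v
    using that(1)[rule_format, of "d - h"] that(2,3) \<open>k \<le> d\<close> by simp
  then show ?thesis using \<open>k \<le> d\<close> by (auto simp: below_def above_def)
qed

context resolved_map begin

lemma subspace_below: "subspace (below d E k)" and subspace_above: "subspace (above d E k)"
  by (auto simp: subspace_def below_def above_def lin_0 lin_add lin_scale lin_E)

lemma below_0: "v \<in> below d E 0 \<Longrightarrow> v = 0"
  by (rule E_eqI) (simp add: below_def lin_0 lin_E)

lemma above_gt: "d < k \<Longrightarrow> v \<in> above d E k \<Longrightarrow> v = 0"
  by (rule E_eqI) (simp add: above_def lin_0 lin_E)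

lemma below_gt: "d < k \<Longrightarrow> v \<in> below d E k"
  by (auto simp: below_def)

text \<open>Subtracting the extreme eigenvalue removes the extreme eigenspace from a partial sum.\<close>
lemma A_minus_theta_above:
  "k \<le> d \<Longrightarrow> v \<in> above d E k \<Longrightarrow> A v - scale (\<theta> k) v \<in> above d E (Suc k)"
  by (auto simp: above_def lin_diff lin_E lin_scale E_A less_Suc_eq)

lemma A_minus_theta_below:
  "k \<le> d \<Longrightarrow> v \<in> below d E (Suc k) \<Longrightarrow> A v - scale (\<theta> k) v \<in> below d E k"
  by (auto simp: below_def lin_diff lin_E lin_scale E_A le_Suc_eq Suc_le_eq order_le_less)

lemma sum_range_E:
  assumes "I \<subseteq> {..d}"
  shows "(\<Sum>h\<in>I. range (E h)) = {v. \<forall>h\<le>d. h \<notin> I \<longrightarrow> E h v = 0}"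
proof -
  have fin: "finite I" using assms finite_subset by blast
  show ?thesis unfolding set_sum_alt[OF fin]
  proof safe
    fix s h assume s: "\<forall>i\<in>I. s i \<in> range (E i)" "h \<le> d" "h \<notin> I"
    have "E h (sum s I) = (\<Sum>i\<in>I. E h (s i))" using s by (simp add: lin_sum lin_E)
    also have "\<dots> = 0"
    proof (rule sum.neutral, rule)
      fix i assume "i \<in> I"
      moreover from this s obtain w where "s i = E i w" by blast
      ultimately show "E h (s i) = 0" using s assms by (auto simp: E_E)
    qed
    finally show "E h (sum s I) = 0" .
  next
    fix v assume v: "\<forall>h\<le>d. h \<notin> I \<longrightarrow> E h v = 0"
    have "v = (\<Sum>h\<le>d. E h v)" by (simp add: sum_E)
    also have "\<dots> = (\<Sum>h\<in>I. E h v)" using assms v by (intro sum.mono_neutral_right) auto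
    finally show "\<exists>s. v = sum s I \<and> (\<forall>i\<in>I. s i \<in> range (E i))" by (intro exI[of _ "\<lambda>h. E h v"]) auto
  qed
qed

end

section \<open>Leading coefficients of products of linear factors\<close>

lemma td_tau_self: "td_tau a i i = 1"
  by (simp add: td_tau_def)

lemma td_tau_Suc: "i \<le> j \<Longrightarrow> td_tau a i (Suc j) = td_tau a i j * [:- a j, 1:]"
  by (simp add: td_tau_def)

lemma td_tau_mult: "i \<le> j \<Longrightarrow> j \<le> k \<Longrightarrow> td_tau a j k * td_tau a i j = td_tau a i k"
  unfolding td_tau_def
  by (simp add: prod.atLeastLessThan_concat mult.commute)

lemma poly_td_tau_eq_0_iff: "i \<le> j \<Longrightarrow> poly (td_tau a i j) x = 0 \<longleftrightarrow> (\<exists>h. i \<le> h \<and> h < j \<and> x = a h)"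
  by (auto simp: td_tau_def poly_prod)

lemma coeff_mult_monic_linear:
  "coeff (p * [:- c, 1:]) (Suc n) = coeff p n - c * coeff p (Suc n)"
  for c :: "'a::comm_ring_1"
  by (simp add: algebra_simps)

lemma coeff_td_tau:
  "coeff (td_tau a i (i + n)) n = 1 \<and> (\<forall>m>n. coeff (td_tau a i (i + n)) m = 0)"
proof (induction n)
  case 0
  show ?case by (auto simp: td_tau_self)
next
  case (Suc n)
  have "coeff (td_tau a i (i + Suc n)) m = 0" if "m > Suc n" for m
    using that Suc td_tau_Suc[of i "i + n" a] by (cases m) (auto simp: coeff_mult_monic_linear)
  then show ?case using Suc td_tau_Suc[of i "i + n" a] by (auto simp: coeff_mult_monic_linear)
qed

lemma coeff_td_tau_nonzero: "i \<le> j \<Longrightarrow> coeff (td_tau a i j) n \<noteq> 0 \<Longrightarrow> i + n \<le> j"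
  using coeff_td_tau[of a i "j - i"] by (metis add_diff_inverse_nat add_left_mono le_add_diff_inverse leI)

lemma coeff_td_tau_second:
  "coeff (td_tau a i (i + Suc n)) n = - (\<Sum>h\<in>{i..<i + Suc n}. a h)"
proof (induction n)
  case 0
  show ?case using td_tau_Suc[of i i a] by (simp add: td_tau_self)
next
  case (Suc n)
  have "coeff (td_tau a i (i + Suc (Suc n))) (Suc n)
      = coeff (td_tau a i (i + Suc n)) n - a (i + Suc n) * coeff (td_tau a i (i + Suc n)) (Suc n)"
    using td_tau_Suc[of i "i + Suc n" a] by (simp only: add_Suc_right coeff_mult_monic_linear)
  also have "\<dots> = - (\<Sum>h\<in>{i..<i + Suc (Suc n)}. a h)"
    using Suc coeff_td_tau[of a i "Suc n"] by simp
  finally show ?case .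
qed

lemma coeff_td_tau_diff:
  assumes "i \<le> j" and "coeff (td_tau a i j - td_tau b i j) n \<noteq> 0"
  shows "i + n < j"
proof (rule ccontr)
  assume "\<not> i + n < j"
  moreover obtain m where "j = i + m" using assms(1) le_Suc_ex by blast
  ultimately show False
    using assms(2) coeff_td_tau[of a i m] coeff_td_tau[of b i m] by (cases "m = n") auto
qed

text \<open>
  Both products are monic of degree \<open>j - i\<close>, and the multiple of \<open>td_tau a i (j - 1)\<close> is chosen
  to cancel the next coefficient, so two leading terms disappear. For \<open>i = j\<close> the empty sum makes
  the last term vanish, whatever \<open>td_tau a i (j - 1)\<close> is.
\<close>
lemma coeff_td_tau_diff_second:
  assumes "i \<le> j"
    and "coeff (td_tau b i j - td_tau a i j
           - smult (\<Sum>h\<in>{i..<j}. a h - b h) (td_tau a i (j - 1))) n \<noteq> 0"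
  shows "Suc (i + n) < j"
proof (rule ccontr)
  assume n: "\<not> Suc (i + n) < j"
  obtain m where m: "j = i + m" using assms(1) le_Suc_ex by blast
  show False
  proof (cases m)
    case 0
    then show False using assms(2) m by (simp add: td_tau_self)
  next
    case (Suc l)
    then have j: "j = i + Suc l" and "l \<le> n" using n m by auto
    show False
      using assms(2) \<open>l \<le> n\<close> coeff_td_tau[of a i l] coeff_td_tau[of a i "Suc l"] coeff_td_tau[of b i "Suc l"]
        coeff_td_tau_second[of a i l] coeff_td_tau_second[of b i l]
      unfolding j
      by (cases "n = l"; cases "n = Suc l") (auto simp: sum_subtractf simp del: sum.op_ivl_Suc)
  qed
qed

section \<open>Tridiagonal systems and the split decomposition\<close>

text \<open>
  A tridiagonal system in terms of idempotents. The axioms are invariant under reversing either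
  order and under exchanging the two maps; the proofs below exploit this by proving a fact once and
  reading it in a transformed system.
\<close>
locale td_resolved = finite_dimensional_vector_space scale Basis
    + a: resolved_map scale d A E \<theta> + s: resolved_map scale d As Es \<theta>s
  for scale :: "'k::field \<Rightarrow> 'v::ab_group_add \<Rightarrow> 'v" and Basis d A E \<theta> As Es \<theta>s +
  assumes E_As_E: "i \<le> d \<Longrightarrow> j \<le> d \<Longrightarrow> i + 1 < j \<or> j + 1 < i \<Longrightarrow> E i (As (E j v)) = 0"
    and Es_A_Es: "i \<le> d \<Longrightarrow> j \<le> d \<Longrightarrow> i + 1 < j \<or> j + 1 < i \<Longrightarrow> Es i (A (Es j v)) = 0"
    and irreducible: "subspace W \<Longrightarrow> A ` W \<subseteq> W \<Longrightarrow> As ` W \<subseteq> W \<Longrightarrow> W = {0} \<or> W = UNIV"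
begin

lemma td_resolved_reverse:
  "td_resolved scale Basis d A (\<lambda>i. E (d - i)) (\<lambda>i. \<theta> (d - i)) As Es \<theta>s"
proof -
  interpret r: resolved_map scale d A "\<lambda>i. E (d - i)" "\<lambda>i. \<theta> (d - i)"
    by (rule a.resolved_map_reverse)
  show ?thesis
  proof unfold_locales
    show "E (d - i) (As (E (d - j) v)) = 0"
      if "i \<le> d" "j \<le> d" "i + 1 < j \<or> j + 1 < i" for i j v
      using that by (intro E_As_E) auto
  qed (use Es_A_Es irreducible in auto)
qed

lemma td_resolved_swap_reverse:
  "td_resolved scale Basis d As (\<lambda>i. Es (d - i)) (\<lambda>i. \<theta>s (d - i))
     A (\<lambda>i. E (d - i)) (\<lambda>i. \<theta> (d - i))"
proof -
  interpret r: resolved_map scale d A "\<lambda>i. E (d - i)" "\<lambda>i. \<theta> (d - i)"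
    by (rule a.resolved_map_reverse)
  interpret rs: resolved_map scale d As "\<lambda>i. Es (d - i)" "\<lambda>i. \<theta>s (d - i)"
    by (rule s.resolved_map_reverse)
  show ?thesis
  proof unfold_locales
    show "E (d - i) (As (E (d - j) v)) = 0" "Es (d - i) (A (Es (d - j) v)) = 0"
      if "i \<le> d" "j \<le> d" "i + 1 < j \<or> j + 1 < i" for i j v
      using that by (auto intro!: E_As_E Es_A_Es)
  qed (use irreducible in auto)
qed

lemma As_above: "v \<in> above d E k \<Longrightarrow> As v \<in> above d E (k - 1)"
proof -
  assume v: "v \<in> above d E k"
  have "E h (As v) = 0" if h: "h \<le> d" "h < k - 1" for h
  proof -
    have "E h (As v) = E h (As (\<Sum>j\<le>d. E j v))" by (simp add: a.sum_E)
    also have "\<dots> = (\<Sum>j\<le>d. E h (As (E j v)))"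
      using h by (simp add: a.lin_sum s.lin_A a.lin_E)
    also have "\<dots> = 0"
    proof (rule sum.neutral, rule)
      fix j assume "j \<in> {..d}"
      then show "E h (As (E j v)) = 0"
        using v h E_As_E[of h j v]
        by (cases "j < k") (auto simp: above_def a.lin_0 s.lin_A a.lin_E less_diff_conv)
    qed
    finally show ?thesis .
  qed
  then show ?thesis by (simp add: above_def)
qed

lemma A_below: "v \<in> below d Es k \<Longrightarrow> A v \<in> below d Es (Suc k)"
proof -
  assume v: "v \<in> below d Es k"
  have "Es h (A v) = 0" if h: "h \<le> d" "Suc k \<le> h" for h
  proof -
    have "Es h (A v) = Es h (A (\<Sum>j\<le>d. Es j v))" by (simp add: s.sum_E)
    also have "\<dots> = (\<Sum>j\<le>d. Es h (A (Es j v)))"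
      using h by (simp add: a.lin_sum a.lin_A s.lin_E)
    also have "\<dots> = 0"
    proof (rule sum.neutral, rule)
      fix j assume "j \<in> {..d}"
      then show "Es h (A (Es j v)) = 0"
        using v h Es_A_Es[of h j v]
        by (cases "k \<le> j") (auto simp: below_def a.lin_0 a.lin_A s.lin_E)
    qed
    finally show ?thesis .
  qed
  then show ?thesis by (simp add: below_def)
qed

text \<open>
  The criterion is stated through the nonzero coefficients instead of the degree, so that
  it covers \<open>p = 0\<close> with no lower bound on \<open>m\<close>.
\<close>
lemma poly_A_below:
  assumes "v \<in> below d Es k" and "\<And>n. coeff p n \<noteq> 0 \<Longrightarrow> k + n \<le> m"
  shows "poly_endo scale p A v \<in> below d Es m"
proof -
  have pow: "(A ^^ n) v \<in> below d Es (k + n)" for n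
    by (induction n) (use assms(1) A_below in auto)
  have "scale (coeff p n) ((A ^^ n) v) \<in> below d Es m" for n
  proof (cases "coeff p n = 0")
    case True
    then show ?thesis using subspace_0[OF s.subspace_below] by simp
  next
    case False
    then show ?thesis
      using pow[of n] assms(2)[of n] below_mono[of "k + n" m d Es]
      by (intro subspace_scale[OF s.subspace_below]) auto
  qed
  then show ?thesis unfolding poly_endo_def
    by (intro subspace_sum[OF s.subspace_below])
qed

text \<open>
  The map \<open>A - \<theta>\<^sub>k\<close> moves a generator to the next one, and \<open>A* - \<theta>*\<^sub>m\<close> with \<open>m = k + c - 1\<close> to
  the previous one. At the two ends, where no neighbour exists, these images are zero.
\<close>
lemma diagonal_span_invariant:
  assumes "c \<le> 1"
  defines "W \<equiv> span (\<Union>k. below d Es (k + c) \<inter> above d E k)"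
  shows "A ` W \<subseteq> W" and "As ` W \<subseteq> W"
proof -
  have base: "x \<in> W" if "x \<in> below d Es (k + c)" "x \<in> above d E k" for x k
    unfolding W_def using that by (intro span_base) auto
  have W: "subspace W" by (simp add: W_def)
  have gen: "A x \<in> W \<and> As x \<in> W" if x: "x \<in> below d Es (k + c)" "x \<in> above d E k" for x k
  proof (cases "k \<le> d \<and> k + c \<noteq> 0")
    case False
    then have "x = 0" using x s.below_0 a.above_gt[of k x] by (cases "k \<le> d") auto
    then show ?thesis by (simp add: a.lin_0 a.lin_A s.lin_A subspace_0 W)
  next
    case True
    then obtain m where m: "k + c = Suc m" "m \<le> d" using assms(1) by (cases "k + c") auto
    have k: "k \<le> d" using True by simp
    have "x \<in> W" using base x by blast
    have "A x - scale (\<theta> k) x \<in> below d Es (Suc k + c)"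
      using x A_below[OF x(1)] below_mono[of "k + c" "Suc k + c" d Es]
      by (intro subspace_diff[OF s.subspace_below] subspace_scale[OF s.subspace_below]) auto
    then have "A x - scale (\<theta> k) x \<in> W"
      using a.A_minus_theta_above[OF k x(2)] base by blast
    then have A: "A x \<in> W"
      using subspace_add[OF W _ subspace_scale[OF W \<open>x \<in> W\<close>], of "A x - scale (\<theta> k) x" "\<theta> k"] by simp
    have low: "As x - scale (\<theta>s m) x \<in> below d Es m"
      using s.A_minus_theta_below[OF m(2)] x m by simp
    have up: "As x - scale (\<theta>s m) x \<in> above d E (k - 1)"
      using x As_above[OF x(2)] above_antimono[of "k - 1" k d E]
      by (intro subspace_diff[OF a.subspace_above] subspace_scale[OF a.subspace_above]) auto
    have "As x - scale (\<theta>s m) x \<in> W"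
    proof (cases k)
      case 0
      then have "m = 0" using m assms(1) by simp
      then have "As x - scale (\<theta>s m) x = 0" using s.below_0 low by blast
      then show ?thesis by (simp only: subspace_0 W)
    next
      case (Suc l)
      then show ?thesis using low up base[of _ l] m by simp
    qed
    then have "As x \<in> W"
      using subspace_add[OF W _ subspace_scale[OF W \<open>x \<in> W\<close>], of "As x - scale (\<theta>s m) x" "\<theta>s m"] by simp
    then show ?thesis using A by simp
  qed
  show "A ` W \<subseteq> W" "As ` W \<subseteq> W"
    using gen W unfolding W_def
    by (intro a.lin_image_span_subset a.lin_A s.lin_A; auto simp: W_def[symmetric])+
qed

text \<open>
  For \<open>c = 0\<close> the generator with \<open>k = 0\<close> is zero, so the invariant span lies in
  \<open>above d E 1\<close> and misses the first eigenspace of \<open>A\<close>.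
\<close>
lemma below_above_eq_0:
  assumes "v \<in> below d Es k" and "v \<in> above d E k"
  shows "v = 0"
proof -
  let ?W = "span (\<Union>k. below d Es (k + 0) \<inter> above d E k)"
  have "x \<in> above d E 1" if "x \<in> below d Es k" "x \<in> above d E k" for x k
    using that s.below_0 above_antimono[of 1 k d E] subspace_0[OF a.subspace_above]
    by (cases "k = 0") auto
  then have "?W \<subseteq> above d E 1"
    by (intro span_minimal a.subspace_above) auto
  moreover have "above d E 1 \<noteq> UNIV"
    using a.E_nonzero[of 0] by (auto simp: above_def)
  ultimately have "?W = {0}"
    using irreducible[OF subspace_span] diagonal_span_invariant[of 0] by auto
  moreover have "v \<in> ?W" using assms by (intro span_base) auto
  ultimately show ?thesis by blast
qed

abbreviation U :: "nat \<Rightarrow> 'v set" where "U k \<equiv> below d Es (Suc k) \<inter> above d E k"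

lemma subspace_U: "subspace (U k)"
  by (intro subspace_inter s.subspace_below a.subspace_above)

text \<open>For \<open>c = 1\<close> the invariant span contains the first eigenspace of \<open>A*\<close>.\<close>
lemma span_U: "span (\<Union>k\<in>{..d}. U k) = UNIV"
proof -
  let ?W = "span (\<Union>k. below d Es (k + 1) \<inter> above d E k)"
  obtain v where v: "Es 0 v \<noteq> 0" using s.E_nonzero[of 0] by auto
  have "Es 0 v \<in> below d Es (0 + 1) \<inter> above d E 0" by (simp add: below_def above_def s.E_E)
  then have "Es 0 v \<in> ?W" by (intro span_base) blast
  then have "?W = UNIV"
    using v irreducible[OF subspace_span] diagonal_span_invariant[of 1] by auto
  moreover have "x \<in> span (\<Union>k\<in>{..d}. U k)" if "x \<in> below d Es (k + 1) \<inter> above d E k" for x k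
    using that a.above_gt[of k x] by (cases "k \<le> d") (auto intro: span_base simp: span_zero)
  then have "?W \<subseteq> span (\<Union>k\<in>{..d}. U k)" by (intro span_minimal) auto
  ultimately show ?thesis by auto
qed

text \<open>
  The first component that does not vanish would be minus the sum of the later ones, hence an
  element of \<open>below d Es (Suc j) \<inter> above d E (Suc j)\<close>.
\<close>
lemma U_independent:
  assumes u: "\<And>j. j \<le> d \<Longrightarrow> u j \<in> U j" and sum: "(\<Sum>j\<le>d. u j) = 0" and "j \<le> d"
  shows "u j = 0"
  using \<open>j \<le> d\<close>
proof (induction j rule: less_induct)
  case (less j)
  have "0 = (\<Sum>i\<le>d. u i)" using sum by simp
  also have "\<dots> = (\<Sum>i\<in>{j..d}. u i)"
    using less by (intro sum.mono_neutral_right) auto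
  also have "\<dots> = u j + (\<Sum>i\<in>{Suc j..d}. u i)"
    using less by (simp add: sum.atLeast_Suc_atMost)
  finally have "u j = - (\<Sum>i\<in>{Suc j..d}. u i)" by (simp add: eq_neg_iff_add_eq_0)
  moreover have "(\<Sum>i\<in>{Suc j..d}. u i) \<in> above d E (Suc j)"
  proof (rule subspace_sum[OF a.subspace_above])
    fix i assume "i \<in> {Suc j..d}"
    then show "u i \<in> above d E (Suc j)" using u[of i] above_antimono[of "Suc j" i d E] by auto
  qed
  ultimately have "u j \<in> above d E (Suc j)"
    using subspace_neg[OF a.subspace_above] by metis
  then show ?case using u[of j] less below_above_eq_0 by auto
qed

text \<open>
  If a vector of \<open>below d Es k\<close> is decomposed, the sum of its components with index at least
  \<open>k\<close> lies in \<open>below d Es k \<inter> above d E k\<close> and therefore vanishes.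
\<close>
lemma below_subset_span_U: "below d Es k \<subseteq> span (\<Union>j\<in>{j. j \<le> d \<and> j < k}. U j)"
proof
  fix v assume v: "v \<in> below d Es k"
  obtain u where u: "\<And>j. j \<le> d \<Longrightarrow> u j \<in> U j" and vu: "v = (\<Sum>j\<le>d. u j)"
    using a.span_UN_image_imp_sum[of "{..d}" "\<lambda>_ x. x" U v] span_U subspace_U
    by (auto simp: a.lin_iff)
  let ?I = "{j. j \<le> d \<and> j < k}" and ?J = "{j. j \<le> d \<and> k \<le> j}"
  have split: "v = (\<Sum>j\<in>?I. u j) + (\<Sum>j\<in>?J. u j)"
    unfolding vu by (subst sum.union_disjoint[symmetric]) (auto intro!: sum.cong)
  have "(\<Sum>j\<in>?I. u j) \<in> below d Es k"
  proof (rule subspace_sum[OF s.subspace_below])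
    fix i assume "i \<in> ?I"
    then show "u i \<in> below d Es k" using u[of i] below_mono[of "Suc i" k d Es] by auto
  qed
  then have "v - (\<Sum>j\<in>?I. u j) \<in> below d Es k"
    by (rule subspace_diff[OF s.subspace_below v])
  moreover have "v - (\<Sum>j\<in>?I. u j) = (\<Sum>j\<in>?J. u j)"
    using split by (simp add: algebra_simps)
  moreover have "(\<Sum>j\<in>?J. u j) \<in> above d E k"
  proof (rule subspace_sum[OF a.subspace_above])
    fix i assume "i \<in> ?J"
    then show "u i \<in> above d E k" using u[of i] above_antimono[of k i d E] by auto
  qed
  ultimately have "v = (\<Sum>j\<in>?I. u j)" using below_above_eq_0 by (metis eq_iff_diff_eq_0)
  moreover have "(\<Sum>j\<in>?I. u j) \<in> span (\<Union>j\<in>?I. U j)"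
    using u by (intro span_sum span_base) auto
  ultimately show "v \<in> span (\<Union>j\<in>?I. U j)" by simp
qed

section \<open>The refined decomposition\<close>

lemma tau_maps_U:
  assumes "i \<le> j" "v \<in> U i"
  shows "poly_endo scale (td_tau \<theta> i j) A v \<in> U j"
proof
  show "poly_endo scale (td_tau \<theta> i j) A v \<in> below d Es (Suc j)"
    using assms coeff_td_tau_nonzero[OF assms(1)] by (intro poly_A_below[of v "Suc i"]) auto
  have "E h (poly_endo scale (td_tau \<theta> i j) A v) = 0" if "h \<le> d" "h < j" for h
    using that assms(2) poly_td_tau_eq_0_iff[OF assms(1), of \<theta> "\<theta> h"]
    by (cases "h < i") (force simp: a.E_poly above_def)+
  then show "poly_endo scale (td_tau \<theta> i j) A v \<in> above d E j"
    by (simp add: above_def)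
qed

lemma tau_kernel:
  assumes "i \<le> j" "poly_endo scale (td_tau \<theta> i j) A v = 0"
  shows "v \<in> below d E j"
proof -
  have "E h v = 0" if "h \<le> d" "j \<le> h" for h
  proof -
    have "poly (td_tau \<theta> i j) (\<theta> h) \<noteq> 0"
      using that poly_td_tau_eq_0_iff[OF assms(1), of \<theta> "\<theta> h"] a.theta_eq_iff by auto
    then show ?thesis
      using a.E_poly[OF that(1), of "td_tau \<theta> i j" v] that assms(2)
      by (simp add: a.lin_0 a.lin_E)
  qed
  then show ?thesis by (simp add: below_def)
qed

text \<open>\<open>below_above_eq_0\<close> for the system with the order of the \<open>E\<^sub>i\<close> reversed.\<close>
lemma below_below_eq_0:
  assumes "v \<in> below d Es i" "v \<in> below d E j" "i + j \<le> Suc d"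
  shows "v = 0"
proof (cases j)
  case 0
  then show ?thesis using assms a.below_0 by simp
next
  case (Suc l)
  interpret r: td_resolved scale Basis d A "\<lambda>i. E (d - i)" "\<lambda>i. \<theta> (d - i)" As Es \<theta>s
    by (rule td_resolved_reverse)
  have "v \<in> above d (\<lambda>i. E (d - i)) (d - l)"
    using assms Suc above_reverse[of "d - l" d E] by simp
  moreover have "v \<in> below d Es (d - l)"
    using assms Suc below_mono[of i "d - l" d Es] by (auto simp: le_diff_conv2)
  ultimately show ?thesis using r.below_above_eq_0 by blast
qed

text \<open>
  The kernel lies in \<open>E\<^sub>0V + \<dots> + E\<^sub>d\<^sub>-\<^sub>i\<^sub>-\<^sub>1V\<close>, which is just small enough to meet
  \<open>E*\<^sub>0V + \<dots> + E*\<^sub>iV\<close> trivially.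
\<close>
lemma tau_injective_U:
  assumes "2 * i \<le> d" "u \<in> U i" "poly_endo scale (td_tau \<theta> i (d - i)) A u = 0"
  shows "u = 0"
  using assms tau_kernel[of i "d - i" u] below_below_eq_0[of u "Suc i" "d - i"] by auto

text \<open>
  Exchanging \<open>A\<close> and \<open>A*\<close> and reversing both orders turns \<open>U\<^sub>i\<close> into \<open>U\<^sub>d\<^sub>-\<^sub>i\<close>, so
  \<open>tau_injective_U\<close> for that system is a map in the opposite direction.
\<close>
lemma injective_lowering_U:
  assumes "2 * i \<le> d"
  shows "\<exists>g. a.lin g \<and> g ` U (d - i) \<subseteq> U i \<and> (\<forall>u\<in>U (d - i). g u = 0 \<longrightarrow> u = 0)"
proof -
  interpret f: td_resolved scale Basis d As "\<lambda>i. Es (d - i)" "\<lambda>i. \<theta>s (d - i)"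
     A "\<lambda>i. E (d - i)" "\<lambda>i. \<theta> (d - i)"
    by (rule td_resolved_swap_reverse)
  have U: "f.U j = U (d - j)" if "j \<le> d" for j
    using that above_reverse[of j d Es] below_reverse[of j d E] by auto
  have "f.U i = U (d - i)" "f.U (d - i) = U i" using U[of i] U[of "d - i"] assms by auto
  then show ?thesis
    using f.tau_maps_U[of i "d - i"] f.tau_injective_U[of i] assms f.a.lin_poly
    by (intro exI[of _ "poly_endo scale (td_tau (\<lambda>i. \<theta>s (d - i)) i (d - i)) As"]) auto
qed

lemma injective_endo_image:
  assumes f: "a.lin f" and S: "subspace S" and "f ` S \<subseteq> S" and "\<And>x. x \<in> S \<Longrightarrow> f x = 0 \<Longrightarrow> x = 0"
  shows "f ` S = S"
proof -
  interpret p: finite_dimensional_vector_space_pair_1 scale Basis scale ..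
  have "inj_on f S"
  proof (rule inj_onI)
    fix x y assume "x \<in> S" "y \<in> S" "f x = f y"
    then have "x - y = 0"
      using assms(4)[of "x - y"] subspace_diff[OF S] by (simp add: a.lin_diff[OF f])
    then show "x = y" by simp
  qed
  then have dim: "dim (f ` S) = dim S"
    using p.dim_image_eq[OF f, of S] unfolding span_eq_iff[THEN iffD2, OF S] by blast
  have "subspace (f ` S)" by (rule p.linear_subspace_image[OF f S])
  then show ?thesis
    using subspace_dim_equal[OF _ S assms(3)] dim by simp
qed

lemma tau_surjective_U:
  assumes i: "2 * i \<le> d"
  shows "poly_endo scale (td_tau \<theta> i (d - i)) A ` U i = U (d - i)"
proof -
  let ?f = "poly_endo scale (td_tau \<theta> i (d - i)) A"
  obtain g where g: "a.lin g" "\<And>u. u \<in> U (d - i) \<Longrightarrow> g u \<in> U i"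
      "\<And>u. u \<in> U (d - i) \<Longrightarrow> g u = 0 \<Longrightarrow> u = 0"
    using injective_lowering_U[OF i] unfolding image_subset_iff by metis
  have f: "?f u \<in> U (d - i)" if "u \<in> U i" for u
    by (rule tau_maps_U[OF _ that]) (use i in simp)
  have img: "(\<lambda>x. ?f (g x)) ` U (d - i) = U (d - i)"
  proof (rule injective_endo_image)
    show "a.lin (\<lambda>x. ?f (g x))" by (intro a.lin_comp[OF a.lin_poly g(1)])
    show "subspace (U (d - i))" by (rule subspace_U)
    show "(\<lambda>x. ?f (g x)) ` U (d - i) \<subseteq> U (d - i)" by (intro image_subsetI f g(2))
    show "x = 0" if "x \<in> U (d - i)" "?f (g x) = 0" for x
      by (rule g(3)[OF that(1) tau_injective_U[OF i g(2)[OF that(1)] that(2)]])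
  qed
  show ?thesis
  proof (rule equalityI)
    show "?f ` U i \<subseteq> U (d - i)" by (intro image_subsetI f)
    have "(\<lambda>x. ?f (g x)) ` U (d - i) \<subseteq> ?f ` U i" by (intro image_subsetI imageI g(2))
    then show "U (d - i) \<subseteq> ?f ` U i" unfolding img .
  qed
qed

text \<open>The inner part \<open>K i\<close> of \<open>U i\<close> is its intersection with the second split component.\<close>
abbreviation K :: "nat \<Rightarrow> 'v set" where "K i \<equiv> U i \<inter> below d E (Suc (d - i))"

lemma subspace_K: "subspace (K i)"
  by (intro subspace_inter subspace_U a.subspace_below)

text \<open>The indices \<open>i\<close> for which \<open>\<tau>\<^sub>i\<^sub>j(A)K\<^sub>i\<close> is a piece of \<open>U j\<close>; they satisfy \<open>2 * i \<le> d\<close> when \<open>j \<le> d\<close>.\<close>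
abbreviation I :: "nat \<Rightarrow> nat set" where "I j \<equiv> {i. i \<le> j \<and> i \<le> d - j}"

lemma finite_I: "finite (I j)"
  by (rule finite_subset[of _ "{..j}"]) auto

lemma tau_span_tau_K:
  assumes "j \<le> k" "I j \<subseteq> I k" "v \<in> span (\<Union>i\<in>I j. poly_endo scale (td_tau \<theta> i j) A ` K i)"
  shows "poly_endo scale (td_tau \<theta> j k) A v \<in> span (\<Union>i\<in>I k. poly_endo scale (td_tau \<theta> i k) A ` K i)"
    (is "_ \<in> ?T")
proof -
  have "poly_endo scale (td_tau \<theta> j k) A `
      span (\<Union>i\<in>I j. poly_endo scale (td_tau \<theta> i j) A ` K i) \<subseteq> ?T"
  proof (rule a.lin_image_span_subset[OF a.lin_poly _ subspace_span])
    fix x assume "x \<in> (\<Union>i\<in>I j. poly_endo scale (td_tau \<theta> i j) A ` K i)"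
    then obtain i u where i: "i \<in> I j" "u \<in> K i" "x = poly_endo scale (td_tau \<theta> i j) A u"
      by blast
    have "poly_endo scale (td_tau \<theta> j k) A x = poly_endo scale (td_tau \<theta> i k) A u"
      using i assms(1) by (simp add: a.poly_endo_mult[symmetric] td_tau_mult)
    then show "poly_endo scale (td_tau \<theta> j k) A x \<in> ?T"
      using i assms(2) by (intro span_base) blast
  qed
  then show ?thesis using assms(3) by blast
qed

text \<open>
  Given \<open>u \<in> U\<^sub>j\<^sub>+\<^sub>1\<close>, surjectivity of \<open>\<tau>\<^sub>j\<^sub>,\<^sub>d\<^sub>-\<^sub>j(A)\<close> on \<open>U\<^sub>j\<close> provides \<open>w \<in> U\<^sub>j\<close> such that \<open>u\<close> and
  \<open>w' = (A - \<theta>\<^sub>j)w\<close> have the same image under \<open>\<tau>\<^sub>j\<^sub>+\<^sub>1\<^sub>,\<^sub>d\<^sub>-\<^sub>j(A)\<close>. Then \<open>u - w'\<close> is killed by that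
  polynomial, which places it in \<open>K\<^sub>j\<^sub>+\<^sub>1\<close>, while \<open>w'\<close> comes from the pieces of \<open>U\<^sub>j\<close>.
\<close>
lemma U_subset_span_tau_K_lower_half:
  assumes "2 * j \<le> d"
  shows "U j \<subseteq> span (\<Union>i\<in>I j. poly_endo scale (td_tau \<theta> i j) A ` K i)"
  using assms
proof (induction j)
  case 0
  have "x \<in> span (poly_endo scale (td_tau \<theta> 0 0) A ` K 0)" if "x \<in> U 0" for x
    using that by (intro span_base image_eqI[of _ _ x]) (auto simp: td_tau_self a.poly_endo_1 a.below_gt)
  moreover have "I 0 = {0}" by auto
  ultimately show ?case by auto
next
  case (Suc j)
  show ?case
  proof
    fix u assume u: "u \<in> U (Suc j)"
    let ?p = "\<lambda>i k. poly_endo scale (td_tau \<theta> i k) A"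
    have "?p (Suc j) (d - j) u \<in> U (d - j)" using u Suc.prems by (intro tau_maps_U) auto
    then obtain w where w: "w \<in> U j" "?p (Suc j) (d - j) u = ?p j (d - j) w"
      using tau_surjective_U[of j] Suc.prems by (auto simp: image_iff)
    define w' where "w' = ?p j (Suc j) w"
    have w': "w' \<in> U (Suc j)" unfolding w'_def using w by (intro tau_maps_U) auto
    have "?p (Suc j) (d - j) (u - w') = 0"
      using w(2) Suc.prems unfolding w'_def
      by (simp add: a.lin_diff[OF a.lin_poly] a.poly_endo_mult[symmetric] td_tau_mult)
    then have "u - w' \<in> below d E (d - j)" using Suc.prems by (intro tau_kernel[of "Suc j"]) auto
    moreover have "d - j = Suc (d - Suc j)" using Suc.prems by auto
    ultimately have K: "u - w' \<in> K (Suc j)" using subspace_diff[OF subspace_U u w'] by auto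
    have "u - w' \<in> span (\<Union>i\<in>I (Suc j). ?p i (Suc j) ` K i)"
    proof (rule span_base, rule UN_I)
      show "Suc j \<in> I (Suc j)" using Suc.prems by auto
      show "u - w' \<in> ?p (Suc j) (Suc j) ` K (Suc j)"
        using K by (intro image_eqI[of _ _ "u - w'"]) (auto simp: td_tau_self a.poly_endo_1)
    qed
    moreover have "w' \<in> span (\<Union>i\<in>I (Suc j). ?p i (Suc j) ` K i)"
      unfolding w'_def
    proof (rule tau_span_tau_K)
      show "I j \<subseteq> I (Suc j)" using Suc.prems by auto
      show "w \<in> span (\<Union>i\<in>I j. ?p i j ` K i)" using w Suc by auto
    qed simp
    ultimately show "u \<in> span (\<Union>i\<in>I (Suc j). ?p i (Suc j) ` K i)"
      using span_add[of "u - w'" _ w'] by simp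
  qed
qed

text \<open>Beyond the middle, \<open>U\<^sub>j\<close> is the image of \<open>U\<^sub>d\<^sub>-\<^sub>j\<close> under \<open>\<tau>\<^sub>d\<^sub>-\<^sub>j\<^sub>,\<^sub>j(A)\<close>.\<close>
lemma U_subset_span_tau_K:
  assumes "j \<le> d"
  shows "U j \<subseteq> span (\<Union>i\<in>I j. poly_endo scale (td_tau \<theta> i j) A ` K i)"
proof (cases "2 * j \<le> d")
  case True
  then show ?thesis by (rule U_subset_span_tau_K_lower_half)
next
  case False
  have half: "2 * (d - j) \<le> d" and dd: "d - (d - j) = j" using False assms by auto
  show ?thesis
  proof
    fix u assume "u \<in> U j"
    then obtain w where w: "w \<in> U (d - j)" "u = poly_endo scale (td_tau \<theta> (d - j) j) A w"
      using tau_surjective_U[OF half] unfolding dd by blast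
    have "w \<in> span (\<Union>i\<in>I (d - j). poly_endo scale (td_tau \<theta> i (d - j)) A ` K i)"
      using w U_subset_span_tau_K_lower_half[OF half] by blast
    then show "u \<in> span (\<Union>i\<in>I j. poly_endo scale (td_tau \<theta> i j) A ` K i)"
      unfolding w(2) using False assms by (intro tau_span_tau_K) auto
  qed
qed

lemma below_subset_span_tau_K:
  "below d Es k \<subseteq> span (\<Union>j\<in>{j. j \<le> d \<and> j < k}. \<Union>i\<in>I j. poly_endo scale (td_tau \<theta> i j) A ` K i)"
  (is "_ \<subseteq> span ?S")
proof -
  have "U j \<subseteq> span ?S" if "j \<le> d" "j < k" for j
    using U_subset_span_tau_K[OF that(1)]
      span_mono[of "\<Union>i\<in>I j. poly_endo scale (td_tau \<theta> i j) A ` K i" ?S] that by blast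
  then have "span (\<Union>j\<in>{j. j \<le> d \<and> j < k}. U j) \<subseteq> span ?S"
    by (intro span_minimal subspace_span) auto
  then show ?thesis using below_subset_span_U by blast
qed

text \<open>
  The vectors of \<open>K\<^sub>i\<close> reach up to \<open>E\<^sub>d\<^sub>-\<^sub>i\<close>, and those of \<open>K\<^sub>l\<close> with \<open>l > i\<close> do not. So \<open>E\<^sub>d\<^sub>-\<^sub>i\<close>
  isolates the term with the smallest index, whose parameter then lies in
  \<open>(E*\<^sub>0V + \<dots> + E*\<^sub>iV) \<inter> (E\<^sub>0V + \<dots> + E\<^sub>d\<^sub>-\<^sub>i\<^sub>-\<^sub>1V) = 0\<close>.
\<close>
lemma tau_K_independent:
  assumes k: "\<And>i. i \<in> I j \<Longrightarrow> k i \<in> K i" and j: "j \<le> d"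
    and sum: "(\<Sum>i\<in>I j. poly_endo scale (td_tau \<theta> i j) A (k i)) = 0" and "i \<in> I j"
  shows "k i = 0"
  using \<open>i \<in> I j\<close>
proof (induction i rule: less_induct)
  case (less i)
  let ?t = "\<lambda>i. poly_endo scale (td_tau \<theta> i j) A (k i)"
  have h: "d - i \<le> d" "j \<le> d - i" using less.prems j by auto
  have "0 = E (d - i) (\<Sum>i\<in>I j. ?t i)" using h by (simp add: sum a.lin_0 a.lin_E)
  also have "\<dots> = (\<Sum>l\<in>I j. E (d - i) (?t l))" using h by (simp add: a.lin_sum a.lin_E)
  also have "\<dots> = (\<Sum>l\<in>{i}. E (d - i) (?t l))"
  proof (rule sum.mono_neutral_right)
    show "\<forall>l\<in>I j - {i}. E (d - i) (?t l) = 0"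
    proof
      fix l assume l: "l \<in> I j - {i}"
      show "E (d - i) (?t l) = 0"
      proof (cases "l < i")
        case True
        then have "k l = 0" using less l by blast
        then show ?thesis using h by (simp add: a.lin_0[OF a.lin_poly] a.lin_0 a.lin_E)
      next
        case False
        then have "Suc (d - l) \<le> d - i" using l by auto
        then have "E (d - i) (k l) = 0" using k[of l] l h by (auto simp: below_def)
        then show ?thesis using h by (simp add: a.E_poly)
      qed
    qed
  qed (use finite_I less.prems in auto)
  finally have "scale (poly (td_tau \<theta> i j) (\<theta> (d - i))) (E (d - i) (k i)) = 0"
    using h by (simp add: a.E_poly)
  moreover have "poly (td_tau \<theta> i j) (\<theta> (d - i)) \<noteq> 0"
    using less.prems h poly_td_tau_eq_0_iff[of i j \<theta> "\<theta> (d - i)"] a.theta_eq_iff by auto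
  ultimately have "E (d - i) (k i) = 0" by simp
  then have "k i \<in> below d E (d - i)"
    using k[OF less.prems] by (auto simp: below_def Suc_le_eq order_le_less)
  then show ?case
    using below_below_eq_0[of "k i" "Suc i" "d - i"] k[OF less.prems] less.prems by auto
qed

text \<open>
  Existence holds for any coefficients \<open>c\<close>, since the parameters \<open>v \<in> K\<^sub>i\<close> of the refined
  decomposition are independent; uniqueness holds because the pieces span \<open>V\<close>. The pairs are taken in
  the order \<open>(j, i)\<close>, so that the sum over all pieces splits into sums inside the \<open>U\<^sub>j\<close>.
\<close>
lemma exists_unique_Psi:
  fixes c :: "nat \<Rightarrow> nat \<Rightarrow> 'k"
  shows "\<exists>!P. a.lin P \<and> (\<forall>i j. 2 * i \<le> d \<longrightarrow> i \<le> j \<longrightarrow> j \<le> d - i \<longrightarrow> (\<forall>v\<in>K i.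
      P (poly_endo scale (td_tau \<theta> i j) A v) = scale (c i j) (poly_endo scale (td_tau \<theta> i (j - 1)) A v)))"
proof -
  let ?p = "\<lambda>i k. poly_endo scale (td_tau \<theta> i k) A"
  let ?P = "SIGMA j:{..d}. I j"
  have span: "span (\<Union>p\<in>?P. ?p (snd p) (fst p) ` K (snd p)) = UNIV"
  proof -
    have "(\<Union>j\<in>{j. j \<le> d \<and> j < Suc d}. \<Union>i\<in>I j. ?p i j ` K i)
        = (\<Union>p\<in>?P. ?p (snd p) (fst p) ` K (snd p))" by force
    then show ?thesis using below_subset_span_tau_K[of "Suc d"] s.below_gt by auto
  qed
  have "\<exists>f. a.lin f \<and> (\<forall>p\<in>?P. \<forall>x\<in>K (snd p). f (?p (snd p) (fst p) x)
      = scale (c (snd p) (fst p)) (?p (snd p) (fst p - 1) x))"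
  proof (rule a.exists_linear_on_direct_sum[OF _ _ _ _ span])
    show "finite ?P" using finite_I by auto
    fix k p
    assume k: "\<And>p. p \<in> ?P \<Longrightarrow> k p \<in> K (snd p)"
      and sum: "(\<Sum>p\<in>?P. ?p (snd p) (fst p) (k p)) = 0" and p: "p \<in> ?P"
    have "(\<Sum>j\<le>d. \<Sum>i\<in>I j. ?p i j (k (j, i))) = 0"
      using sum finite_I by (subst sum.Sigma) (auto simp: case_prod_beta)
    then have "(\<Sum>i\<in>I j. ?p i j (k (j, i))) = 0" if "j \<le> d" for j
      using that k
      by (intro U_independent[of "\<lambda>j. \<Sum>i\<in>I j. ?p i j (k (j, i))"] subspace_sum[OF subspace_U] tau_maps_U)
        fastforce+
    then show "k p = 0"
      using tau_K_independent[of "fst p" "\<lambda>i. k (fst p, i)" "snd p"] k p by fastforce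
  qed (simp_all add: a.lin_poly a.lin_scale_fun subspace_K)
  then obtain f where f: "a.lin f"
    "\<And>i j x. 2 * i \<le> d \<Longrightarrow> i \<le> j \<Longrightarrow> j \<le> d - i \<Longrightarrow> x \<in> K i \<Longrightarrow> f (?p i j x) = scale (c i j) (?p i (j - 1) x)"
    by fastforce
  show ?thesis
  proof (rule ex1I[of _ f])
    fix g assume g: "a.lin g \<and> (\<forall>i j. 2 * i \<le> d \<longrightarrow> i \<le> j \<longrightarrow> j \<le> d - i \<longrightarrow> (\<forall>v\<in>K i.
      g (?p i j v) = scale (c i j) (?p i (j - 1) v)))"
    show "g = f"
    proof (rule a.lin_eq_on_span[OF _ f(1) _ span])
      fix x assume "x \<in> (\<Union>p\<in>?P. ?p (snd p) (fst p) ` K (snd p))"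
      then obtain i j v where "j \<le> d" "i \<in> I j" "v \<in> K i" "x = ?p i j v" by auto
      then show "g x = f x" using g f(2)[of i j v] by auto
    qed (use g in auto)
  qed (use f in auto)
qed

section \<open>The maps \<open>\<Delta>\<close> and \<open>\<Psi>\<close>\<close>

lemma sum_range_Es: "(\<Sum>h\<in>{0..i}. range (Es h)) = below d Es (Suc i)" if "i \<le> d"
  using s.sum_range_E[of "{0..i}"] that by (auto simp: below_def not_le Suc_le_eq)

lemma split_U_eq: "i \<le> d \<Longrightarrow> split_U d E Es i = U i"
  using a.sum_range_E[of "{i..d}"] by (auto simp: split_U_def sum_range_Es above_def not_le)

lemma split_U_down_eq:
  "i \<le> d \<Longrightarrow> split_U_down d E Es i = below d Es (Suc i) \<inter> below d E (Suc (d - i))"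
  using a.sum_range_E[of "{0..d - i}"]
  by (auto simp: split_U_down_def sum_range_Es below_def not_le Suc_le_eq)

lemma td_K_eq: "2 * i \<le> d \<Longrightarrow> td_K d E Es i = K i"
  using a.sum_range_E[of "{i..d - i}"]
  by (auto simp: td_K_def sum_range_Es above_def below_def not_le Suc_le_eq)

text \<open>
  The family \<open>V\<close> stands for the first or, in the reversed system, the second split decomposition;
  beyond index \<open>d\<close> the intervals in their definitions degenerate.
\<close>
lemma component_projection_U:
  assumes V: "\<forall>j\<le>d. V j = U j" and i: "i \<le> d"
  defines "F \<equiv> component_projection scale d V i"
  shows "a.lin F" and "\<And>v. v \<in> U i \<Longrightarrow> F v = v"
    and "\<And>j v. j \<le> d \<Longrightarrow> j \<noteq> i \<Longrightarrow> v \<in> U j \<Longrightarrow> F v = 0"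
proof -
  have sub: "subspace (V j)" if "j \<le> d" for j
    using that subspace_U V by simp
  have span: "span (\<Union>j\<in>{..d}. V j) = UNIV"
    using span_U V by simp
  have ind: "\<forall>u. (\<forall>j\<le>d. u j \<in> V j) \<longrightarrow> (\<Sum>j\<le>d. u j) = 0 \<longrightarrow> (\<forall>j\<le>d. u j = 0)"
    using U_independent V by blast
  note * = a.component_projection_direct_sum[of d V, OF sub span ind i, folded F_def]
  show "a.lin F" by (rule *(1))
  show "F v = v" if "v \<in> U i" for v using that V i *(2) by simp
  show "F v = 0" if "j \<le> d" "j \<noteq> i" "v \<in> U j" for j v using that V *(3) by simp
qed

text \<open>
  On \<open>U\<^sub>j\<close> the map \<open>\<Delta>\<close> is the projection to the \<open>j\<close>-th component of the second split decomposition.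
  That projection kills \<open>below d Es j\<close>, the sum of the earlier components, which contains the
  difference of \<open>\<tau>\<^sub>i\<^sub>j(A)v\<close> and the right-hand side; and it fixes the right-hand side, because
  \<open>K\<^sub>i\<close> also lies in the \<open>i\<close>-th component of the second decomposition.
\<close>
lemma lin_td_Delta: "a.lin (td_Delta scale d E Es)"
  and td_Delta_tau: "i \<le> j \<Longrightarrow> j \<le> d - i \<Longrightarrow> v \<in> K i \<Longrightarrow>
    td_Delta scale d E Es (poly_endo scale (td_tau \<theta> i j) A v)
      = poly_endo scale (td_tau (\<lambda>h. \<theta> (d - h)) i j) A v"
proof -
  interpret r: td_resolved scale Basis d A "\<lambda>i. E (d - i)" "\<lambda>i. \<theta> (d - i)" As Es \<theta>s
    by (rule td_resolved_reverse)
  let ?F = "component_projection scale d (split_U d E Es)"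
  let ?G = "component_projection scale d (split_U_down d E Es)"
  have down: "split_U_down d E Es i = r.U i" if "i \<le> d" for i
    using that by (simp add: split_U_down_eq above_reverse)
  have V: "\<forall>j\<le>d. split_U d E Es j = U j" "\<forall>j\<le>d. split_U_down d E Es j = r.U j"
    by (simp_all add: split_U_eq down)
  note F = component_projection_U[OF V(1)]
  note G = r.component_projection_U[OF V(2)]
  show "a.lin (td_Delta scale d E Es)"
    unfolding td_Delta_def[abs_def]
    by (rule a.lin_sum_fun, rule a.lin_comp[OF G(1) F(1)]) simp_all
  assume ij: "i \<le> j" "j \<le> d - i" and v: "v \<in> K i"
  let ?u = "poly_endo scale (td_tau \<theta> i j) A v"
  let ?w = "poly_endo scale (td_tau (\<lambda>h. \<theta> (d - h)) i j) A v"
  have j: "j \<le> d" using ij by auto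
  have u: "?u \<in> U j" using v ij by (intro tau_maps_U) auto
  have "v \<in> r.U i" using v above_reverse[of i d E] ij by simp
  then have w: "?w \<in> r.U j" using ij by (intro r.tau_maps_U) auto
  have "td_Delta scale d E Es ?u = (\<Sum>h=0..d. if h = j then ?G j ?u else 0)"
    unfolding td_Delta_def using F(2)[OF j u] F(3)[OF _ j _ u] G(1)
    by (intro sum.cong) (auto simp: a.lin_0)
  also have "\<dots> = ?G j ?u" using j by simp
  also have "\<dots> = ?G j ?w"
  proof -
    have "poly_endo scale (td_tau \<theta> i j - td_tau (\<lambda>h. \<theta> (d - h)) i j) A v \<in> below d Es j"
      using v coeff_td_tau_diff[OF ij(1)] by (intro poly_A_below[of v "Suc i"]) (auto simp: Suc_le_eq)
    then have "?u - ?w \<in> below d Es j" by (simp add: a.poly_endo_diff)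
    then have "?u - ?w \<in> span (\<Union>h\<in>{h. h \<le> d \<and> h < j}. r.U h)"
      using r.below_subset_span_U by blast
    moreover have "?G j ` span (\<Union>h\<in>{h. h \<le> d \<and> h < j}. r.U h) \<subseteq> {0}"
    proof (rule a.lin_image_span_subset)
      fix x assume "x \<in> (\<Union>h\<in>{h. h \<le> d \<and> h < j}. r.U h)"
      then show "?G j x \<in> {0}" using G(3)[OF j, of _ x] by auto
    qed (use G(1)[OF j] in auto)
    ultimately have "?G j (?u - ?w) = 0" by blast
    then show ?thesis using a.lin_diff[OF G(1)[OF j]] by simp
  qed
  also have "\<dots> = ?w" by (rule G(2)[OF j w])
  finally show "td_Delta scale d E Es ?u = ?w" .
qed

text \<open>
  The definition of \<open>\<Psi>\<close> refers to the eigenvalues as \<open>td_theta\<close>, and \<open>d \<ge> 1\<close> makes the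
  denominator \<open>\<theta>\<^sub>0 - \<theta>\<^sub>d\<close> of the coefficients \<open>\<vartheta>\<^sub>i\<close> nonzero.
\<close>
context
  assumes theta: "td_theta scale A E = \<theta>" and d: "1 \<le> d"
begin

abbreviation \<Delta> where "\<Delta> \<equiv> td_Delta scale d E Es"
abbreviation \<Psi> where "\<Psi> \<equiv> td_Psi scale d A E Es"
abbreviation \<kappa> where "\<kappa> \<equiv> \<theta> 0 - \<theta> d"

lemma lin_td_Psi: "a.lin \<Psi>"
  and td_Psi_tau: "2 * i \<le> d \<Longrightarrow> i \<le> j \<Longrightarrow> j \<le> d - i \<Longrightarrow> v \<in> K i \<Longrightarrow>
    \<Psi> (poly_endo scale (td_tau \<theta> i j) A v) = scale (td_vartheta d \<theta> j - td_vartheta d \<theta> i)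
      (poly_endo scale (td_tau \<theta> i (j - 1)) A v)"
proof -
  let ?Q = "\<lambda>P. a.lin P \<and> (\<forall>i j. 2 * i \<le> d \<longrightarrow> i \<le> j \<longrightarrow> j \<le> d - i \<longrightarrow> (\<forall>v\<in>K i.
      P (poly_endo scale (td_tau \<theta> i j) A v) = scale (td_vartheta d \<theta> j - td_vartheta d \<theta> i)
        (poly_endo scale (td_tau \<theta> i (j - 1)) A v)))"
  have "\<Psi> = (THE P. ?Q P)"
    unfolding td_Psi_def Let_def theta
    by (intro arg_cong[of _ _ The] ext conj_cong all_cong1 imp_cong refl) (auto simp: td_K_eq)
  then have "?Q \<Psi>"
    using theI'[OF exists_unique_Psi[of "\<lambda>i j. td_vartheta d \<theta> j - td_vartheta d \<theta> i"]] by simp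
  then show "a.lin \<Psi>" and "2 * i \<le> d \<Longrightarrow> i \<le> j \<Longrightarrow> j \<le> d - i \<Longrightarrow> v \<in> K i \<Longrightarrow>
    \<Psi> (poly_endo scale (td_tau \<theta> i j) A v) = scale (td_vartheta d \<theta> j - td_vartheta d \<theta> i)
      (poly_endo scale (td_tau \<theta> i (j - 1)) A v)" by blast+
qed

lemma kappa_vartheta_diff:
  assumes "i \<le> j"
  shows "\<kappa> * (td_vartheta d \<theta> j - td_vartheta d \<theta> i) = (\<Sum>h\<in>{i..<j}. \<theta> h - \<theta> (d - h))"
proof -
  have "\<kappa> \<noteq> 0" using d a.theta_eq_iff[of 0 d] by simp
  have "td_vartheta d \<theta> j - td_vartheta d \<theta> i = (\<Sum>h\<in>{i..<j}. (\<theta> h - \<theta> (d - h)) / \<kappa>)"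
    unfolding td_vartheta_def using sum_diff_nat_ivl[of 0 i j] assms
    by (simp add: atLeast0LessThan[symmetric])
  then show ?thesis using \<open>\<kappa> \<noteq> 0\<close> by (simp add: sum_divide_distrib[symmetric])
qed

text \<open>
  Both maps are tested on the vectors \<open>\<tau>\<^sub>i\<^sub>j(A)v\<close> with \<open>v \<in> K\<^sub>i\<close> and \<open>j < k\<close>, which span
  \<open>below d Es k\<close>. There they are polynomials in \<open>A\<close> applied to \<open>v\<close>, and cancellation of one or two
  leading coefficients lowers the flag by one or two steps.
\<close>
lemma Delta_minus_id_below: "v \<in> below d Es k \<Longrightarrow> \<Delta> v - v \<in> below d Es (k - 1)"
  and Delta_minus_Psi_below:
    "v \<in> below d Es k \<Longrightarrow> \<Delta> v - v - scale \<kappa> (\<Psi> v) \<in> below d Es (k - 2)"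
proof -
  let ?S = "\<Union>j\<in>{j. j \<le> d \<and> j < k}. \<Union>i\<in>I j. poly_endo scale (td_tau \<theta> i j) A ` K i"
  have gen: "\<Delta> x - x \<in> below d Es (k - 1) \<and> \<Delta> x - x - scale \<kappa> (\<Psi> x) \<in> below d Es (k - 2)"
    if xS: "x \<in> ?S" for x
  proof -
    obtain i j v where j: "j \<le> d" "j < k" and i: "i \<le> j" "i \<le> d - j" and v: "v \<in> K i"
      and x: "x = poly_endo scale (td_tau \<theta> i j) A v" using xS by auto
    let ?t = "td_tau \<theta> i j" and ?t' = "td_tau (\<lambda>h. \<theta> (d - h)) i j"
    let ?c = "\<Sum>h\<in>{i..<j}. \<theta> h - \<theta> (d - h)"
    have v': "v \<in> below d Es (Suc i)" using v by auto
    have ij: "2 * i \<le> d" "j \<le> d - i" using i j by auto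
    have \<Delta>x: "\<Delta> x = poly_endo scale ?t' A v"
      unfolding x using i ij v by (intro td_Delta_tau)
    have "scale \<kappa> (\<Psi> x) = poly_endo scale (smult ?c (td_tau \<theta> i (j - 1))) A v"
      unfolding x td_Psi_tau[OF ij(1) i(1) ij(2) v] using kappa_vartheta_diff[OF i(1)]
      by (simp add: a.poly_endo_smult)
    then have "\<Delta> x - x = poly_endo scale (?t' - ?t) A v"
      and "\<Delta> x - x - scale \<kappa> (\<Psi> x)
        = poly_endo scale (?t' - ?t - smult ?c (td_tau \<theta> i (j - 1))) A v"
      using \<Delta>x x by (simp_all add: a.poly_endo_diff)
    moreover have "poly_endo scale (?t' - ?t) A v \<in> below d Es (k - 1)"
      using coeff_td_tau_diff[OF i(1)] j by (intro poly_A_below[OF v']) force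
    moreover have "poly_endo scale (?t' - ?t - smult ?c (td_tau \<theta> i (j - 1))) A v \<in> below d Es (k - 2)"
      using coeff_td_tau_diff_second[OF i(1), of "\<lambda>h. \<theta> (d - h)" \<theta>] j
      by (intro poly_A_below[OF v']) force
    ultimately show ?thesis by simp
  qed
  have lin1: "a.lin (\<lambda>v. \<Delta> v - v)"
    using lin_td_Delta by (simp add: a.lin_iff scale_right_diff_distrib)
  have lin2: "a.lin (\<lambda>v. \<Delta> v - v - scale \<kappa> (\<Psi> v))"
    using lin_td_Delta lin_td_Psi
    by (simp add: a.lin_iff scale_right_diff_distrib scale_right_distrib scale_left_commute)
  have "v \<in> span ?S" if "v \<in> below d Es k" using that below_subset_span_tau_K by blast
  then show "v \<in> below d Es k \<Longrightarrow> \<Delta> v - v \<in> below d Es (k - 1)"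
    and "v \<in> below d Es k \<Longrightarrow> \<Delta> v - v - scale \<kappa> (\<Psi> v) \<in> below d Es (k - 2)"
    using a.lin_image_span_subset[OF lin1, of ?S "below d Es (k - 1)"]
      a.lin_image_span_subset[OF lin2, of ?S "below d Es (k - 2)"] gen s.subspace_below by blast+
qed

text \<open>
  From \<open>w = \<Delta>w - (\<Delta>w - w)\<close> a position of \<open>w\<close> in the flag above that of \<open>\<Delta>w\<close> can be
  lowered step by step. For \<open>k = 0\<close> this is the injectivity of \<open>\<Delta>\<close>.
\<close>
lemma Delta_preimage_below:
  assumes "\<Delta> w \<in> below d Es k"
  shows "w \<in> below d Es k"
proof -
  have "w \<in> below d Es (k + n) \<Longrightarrow> w \<in> below d Es k" for n
  proof (induction n)
    case (Suc n)
    have "\<Delta> w - w \<in> below d Es (k + n)" using Delta_minus_id_below[OF Suc.prems] by simp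
    moreover have "\<Delta> w \<in> below d Es (k + n)" using assms below_mono[of k "k + n" d Es] by auto
    ultimately have "\<Delta> w - (\<Delta> w - w) \<in> below d Es (k + n)"
      by (metis subspace_diff[OF s.subspace_below])
    moreover have "\<Delta> w - (\<Delta> w - w) = w" by simp
    ultimately show ?case using Suc.IH by metis
  qed simp
  from this[of "Suc d"] show ?thesis using s.below_gt[of "k + Suc d" w] by simp
qed

lemma surj_Delta: "surj \<Delta>"
proof -
  have "x = 0" if "\<Delta> x = 0" for x
    using that Delta_preimage_below[of x 0] subspace_0[OF s.subspace_below] s.below_0 by simp
  then show ?thesis using injective_endo_image[OF lin_td_Delta subspace_UNIV] by auto
qed

text \<open>
  With \<open>w = \<Delta>\<inverse>v\<close> and \<open>n = \<Delta>w - w = v - w\<close>, the vector in question is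
  \<open>(\<theta>\<^sub>0 - \<theta>\<^sub>d)\<Psi>n - (\<Delta>w - w - (\<theta>\<^sub>0 - \<theta>\<^sub>d)\<Psi>w)\<close>. The second term is covered by
  \<open>Delta_minus_Psi_below\<close>; in the first one \<open>n\<close> is already one step down and \<open>\<Psi>\<close> takes
  it one step further.
\<close>
lemma inv_Delta_plus_Psi_below:
  assumes "v \<in> below d Es k"
  shows "inv \<Delta> v - v + scale \<kappa> (\<Psi> v) \<in> below d Es (k - 2)"
proof -
  define w where "w = inv \<Delta> v"
  define n where "n = \<Delta> w - w"
  have \<Delta>w: "\<Delta> w = v" unfolding w_def by (simp add: surj_f_inv_f surj_Delta)
  then have w: "w \<in> below d Es k" using assms Delta_preimage_below by simp
  have n: "n \<in> below d Es (k - 1)" unfolding n_def by (rule Delta_minus_id_below[OF w])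
  have v: "v = w + n" using \<Delta>w by (simp add: n_def)
  have "\<Delta> n - n \<in> below d Es (k - 2)"
    using Delta_minus_id_below[OF n] by (simp add: numeral_2_eq_2)
  moreover have "\<Delta> n - n - scale \<kappa> (\<Psi> n) \<in> below d Es (k - 2)"
    using Delta_minus_Psi_below[OF n] below_mono[of "k - 1 - 2" "k - 2" d Es] by (simp add: subset_iff)
  ultimately have "(\<Delta> n - n) - (\<Delta> n - n - scale \<kappa> (\<Psi> n)) \<in> below d Es (k - 2)"
    by (rule subspace_diff[OF s.subspace_below])
  then have "scale \<kappa> (\<Psi> n) - (\<Delta> w - w - scale \<kappa> (\<Psi> w)) \<in> below d Es (k - 2)"
    using subspace_diff[OF s.subspace_below _ Delta_minus_Psi_below[OF w]] by simp
  also have "scale \<kappa> (\<Psi> n) - (\<Delta> w - w - scale \<kappa> (\<Psi> w)) = w - v + scale \<kappa> (\<Psi> v)"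
    unfolding \<Delta>w by (simp add: v a.lin_add[OF lin_td_Psi] scale_right_distrib algebra_simps)
  finally show ?thesis unfolding w_def .
qed

end

end

section \<open>Idempotents of a tridiagonal system\<close>

text \<open>
  Diagonalizability gives completeness: the sum of the idempotents fixes every
  eigenvector, hence every vector. The ordering guarantees that distinct indices belong to distinct
  eigenspaces, which gives orthogonality and distinct eigenvalues.
\<close>

lemma resolved_map_primitive_idempotents:
  fixes scale :: "'k::field \<Rightarrow> 'v::ab_group_add \<Rightarrow> 'v"
  assumes vs: "vector_space scale" and A: "Vector_Spaces.linear scale scale A"
    and diag: "diagonalizable scale A"
    and idem: "bij_betw E {..d} (primitive_idempotents scale A)"
    and ord: "standard_ordering scale A As d (\<lambda>i. range (E i))"
  shows "resolved_map scale d A E (td_theta scale A E)"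
proof -
  interpret linear_operators scale
    using vs by (simp add: linear_operators_def)
  let ?W = "\<lambda>i. range (E i)"
  have bij: "bij_betw ?W {..d} (eigenspaces scale A)"
    using ord by (simp add: standard_ordering_def)
  have E: "lin (E i)" "\<And>v. E i (E i v) = E i v"
      "\<And>j v. j \<le> d \<Longrightarrow> j \<noteq> i \<Longrightarrow> E i (E j v) = 0" if i: "i \<le> d" for i
  proof -
    have "E i \<in> primitive_idempotents scale A" using idem i by (auto simp: bij_betw_def)
    then obtain W where W: "W \<in> eigenspaces scale A"
        "is_projection scale W (\<Union>(eigenspaces scale A - {W})) (E i)"
      by (auto simp: primitive_idempotents_def)
    then have rW: "?W i = W" by (simp add: is_projection_def)
    show "lin (E i)" "E i (E i v) = E i v" for v
      using W rW by (auto simp: is_projection_def)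
    show "E i (E j v) = 0" if j: "j \<le> d" "j \<noteq> i" for j v
    proof -
      have "?W j \<in> eigenspaces scale A" "?W j \<noteq> ?W i"
        using bij i j by (auto simp: bij_betw_def inj_on_def)
      then have "E j v \<in> \<Union>(eigenspaces scale A - {W})" using rW by blast
      then show ?thesis using W by (auto simp: is_projection_def)
    qed
  qed
  have ex: "\<exists>c. ?W i = eigenspace scale A c \<and> ?W i \<noteq> {0}" if "i \<le> d" for i
  proof -
    have "?W i \<in> eigenspaces scale A" using that bij by (auto simp: bij_betw_def)
    then show ?thesis by (auto simp: eigenspaces_def)
  qed
  have nonzero: "\<exists>v. E i v \<noteq> 0" if "i \<le> d" for i
  proof (rule ccontr)
    assume "\<nexists>v. E i v \<noteq> 0"
    then have "?W i = {0}" by auto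
    then show False using ex[OF that] by blast
  qed
  have theta: "?W i = eigenspace scale A (td_theta scale A E i)" if i: "i \<le> d" for i
  proof -
    obtain c where c: "?W i = eigenspace scale A c" using ex[OF i] by auto
    obtain v where v: "E i v \<noteq> 0" using nonzero[OF i] by auto
    have "td_theta scale A E i = c"
      unfolding td_theta_def
    proof (rule the_equality)
      show "\<forall>v\<in>?W i. A v = scale c v" using c by (auto simp: eigenspace_def)
      fix c' assume "\<forall>v\<in>?W i. A v = scale c' v"
      then have "scale c' (E i v) = scale c (E i v)" using c by (auto simp: eigenspace_def)
      then show "c' = c" using v by simp
    qed
    then show ?thesis using c by simp
  qed
  have sum: "(\<Sum>i\<le>d. E i v) = v" for v
  proof -
    obtain B where B: "\<not> dependent B" "span B = UNIV" "\<forall>b\<in>B. \<exists>c. A b = scale c b"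
      using diag by (auto simp: diagonalizable_def)
    have "(\<lambda>v. \<Sum>i\<le>d. E i v) = (\<lambda>v. v)"
    proof (rule lin_eq_on_span[OF _ _ _ B(2)])
      show "lin (\<lambda>v. \<Sum>i\<le>d. E i v)" using E(1) by (intro lin_sum_fun) auto
      show "lin (\<lambda>v. v)" by (simp add: lin_iff)
      fix b assume b: "b \<in> B"
      then obtain c where c: "A b = scale c b" using B by blast
      have "b \<noteq> 0" using b B(1) dependent_zero by blast
      then have "eigenspace scale A c \<in> eigenspaces scale A"
        using c by (auto simp: eigenspaces_def eigenspace_def)
      then obtain j where j: "j \<le> d" "?W j = eigenspace scale A c"
        using bij by (metis (no_types, lifting) atMost_iff bij_betw_iff_bijections)
      then have "b \<in> ?W j" using c by (simp add: eigenspace_def)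
      then obtain w where w: "b = E j w" by blast
      have "(\<Sum>i\<le>d. E i b) = (\<Sum>i\<le>d. if i = j then b else 0)"
        using E j w by (intro sum.cong) auto
      then show "(\<Sum>i\<le>d. E i b) = b" using j by simp
    qed
    then show ?thesis by metis
  qed
  show ?thesis
  proof (rule resolved_map.intro[OF linear_operators_axioms resolved_map_axioms.intro])
    show "E i (E j v) = (if i = j then E j v else 0)" if "i \<le> d" "j \<le> d" for i j v
      using E that by auto
    show "A (E i v) = scale (td_theta scale A E i) (E i v)" if "i \<le> d" for i v
      using theta[OF that] rangeI[of "E i" v] by (simp add: eigenspace_def)
    show "inj_on (td_theta scale A E) {..d}"
      using theta bij by (auto simp: inj_on_def bij_betw_def)
  qed (use A E(1) sum nonzero in auto)
qed

lemma standard_ordering_tridiagonal: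
  assumes "resolved_map scale d A E \<theta>"
    and ord: "standard_ordering scale A As d (\<lambda>i. range (E i))"
    and ij: "i \<le> d" "j \<le> d" "i + 1 < j \<or> j + 1 < i"
  shows "E i (As (E j v)) = 0"
proof -
  interpret resolved_map scale d A E \<theta> by fact
  let ?L = "if j = 0 then {0} else range (E (j - 1))" and ?R = "if j = d then {0} else range (E (j + 1))"
  have "As (E j v) \<in> ?L + range (E j) + ?R"
    using ord ij unfolding standard_ordering_def by blast
  then obtain x y z where xyz: "As (E j v) = x + y + z" "x \<in> ?L" "y \<in> range (E j)" "z \<in> ?R"
    by (auto elim!: set_plus_elim)
  have "E i x = 0" "E i y = 0" "E i z = 0"
    using xyz ij by (auto simp: E_E lin_0 lin_E split: if_splits)
  then show ?thesis using xyz ij by (simp add: lin_add lin_E)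
qed

lemma td_resolved_td_system:
  assumes "finite_dimensional_vector_space scale Basis" and "td_system scale d A E As Es"
  shows "td_resolved scale Basis d A E (td_theta scale A E) As Es (td_theta scale As Es)"
proof -
  interpret finite_dimensional_vector_space scale Basis by fact
  have td: "td_pair scale A As" "bij_betw E {..d} (primitive_idempotents scale A)"
    "standard_ordering scale A As d (\<lambda>i. range (E i))"
    "bij_betw Es {..d} (primitive_idempotents scale As)"
    "standard_ordering scale As A d (\<lambda>i. range (Es i))"
    using assms(2) by (auto simp: td_system_def)
  interpret a: resolved_map scale d A E "td_theta scale A E"
    by (rule resolved_map_primitive_idempotents[OF vector_space_axioms _ _ td(2,3)])
      (use td(1) in \<open>auto simp: td_pair_def\<close>)
  interpret s: resolved_map scale d As Es "td_theta scale As Es"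
    by (rule resolved_map_primitive_idempotents[OF vector_space_axioms _ _ td(4,5)])
      (use td(1) in \<open>auto simp: td_pair_def\<close>)
  show ?thesis
  proof unfold_locales
    show "E i (As (E j v)) = 0" if "i \<le> d" "j \<le> d" "i + 1 < j \<or> j + 1 < i" for i j v
      by (rule standard_ordering_tridiagonal[OF a.resolved_map_axioms td(3) that])
    show "Es i (A (Es j v)) = 0" if "i \<le> d" "j \<le> d" "i + 1 < j \<or> j + 1 < i" for i j v
      by (rule standard_ordering_tridiagonal[OF s.resolved_map_axioms td(5) that])
    show "W = {0} \<or> W = UNIV" if "subspace W" "A ` W \<subseteq> W" "As ` W \<subseteq> W" for W
      using td(1) that unfolding td_pair_def by blast
  qed
qed

theorem lemma16p2:
  fixes scale :: "'k::field \<Rightarrow> 'v::ab_group_add \<Rightarrow> 'v"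
    and Basis :: "'v set"
    and d j :: nat
    and A As X :: "'v \<Rightarrow> 'v"
    and E Es :: "nat \<Rightarrow> 'v \<Rightarrow> 'v"
  assumes "finite_dimensional_vector_space scale Basis"
    and "0 < vector_space.dim scale (UNIV :: 'v set)"
    and "td_system scale d A E As Es"
    and "1 \<le> d"
    and "j \<le> d"
    and "X \<in> {\<lambda>v. td_Delta scale d E Es v - v
                   - scale (td_theta scale A E 0 - td_theta scale A E d) (td_Psi scale d A E Es v),
              \<lambda>v. inv (td_Delta scale d E Es) v - v
                   + scale (td_theta scale A E 0 - td_theta scale A E d) (td_Psi scale d A E Es v)}"
  shows "(2 \<le> j \<longrightarrow> X ` range (Es j) \<subseteq> (\<Sum>h\<in>{0..j - 2}. range (Es h)))
    \<and> (j < 2 \<longrightarrow> X ` range (Es j) = {0})"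
proof -
  interpret td_resolved scale Basis d A E "td_theta scale A E" As Es "td_theta scale As Es"
    by (rule td_resolved_td_system[OF assms(1,3)])
  have X: "X (Es j v) \<in> below d Es (j - 1)" for v
  proof -
    have "Es j v \<in> below d Es (Suc j)" using assms(5) by (auto simp: below_def s.E_E)
    from Delta_minus_Psi_below[OF refl assms(4) this] inv_Delta_plus_Psi_below[OF refl assms(4) this]
    show ?thesis using assms(6) by auto
  qed
  have "X ` range (Es j) \<subseteq> (\<Sum>h\<in>{0..j - 2}. range (Es h))" if "2 \<le> j"
  proof -
    have "Suc (j - 2) = j - 1" using that by simp
    then show ?thesis using X assms(5) by (auto simp: sum_range_Es)
  qed
  moreover have "X ` range (Es j) = {0}" if "j < 2"
  proof -
    have "X (Es j v) = 0" for v using X[of v] that s.below_0 by (simp add: less_2_cases_iff)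
    then show ?thesis by (simp add: image_image)
  qed
  ultimately show ?thesis by blast
qed

end
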